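(* Let $K$ be a field and let $\Delta$ be a simplicial complex on the vertex set $V(\Delta)=\{x_1,\dots,x_n\}$. For every vertex $x_i$, add to $\Delta$ a facet $F_i$ of dimension $\geq 1$ such that - $F_i\cap V(\Delta)=\{x_i\}$ for every $i=1,\dots,n$, - $F_i\cap F_j=\varnothing$ for all $i,j=1,\dots,n$ with $i\neq j$. Let $\Delta'$ be the simplicial complex obtained in this way, i.e. $\Delta'=\Delta\cup\langle F_1\rangle\cup\dots\cup\langle F_n\rangle$, where $\langle F\rangle$ denotes the simplex spanned by $F$ (the set of all subsets of $F$). Let $I(\Delta')$ be the facet ideal of $\Delta'$. Then $$\operatorname{ht} I(\Delta')=\operatorname{ara} I(\Delta')=n,$$ and thus $I(\Delta')$ is a set-theoretic complete intersection.
   Context: Simplicial complexes are finite, and every element of the vertex set is a vertex (i.e. $\{x_i\}\in\Delta$ for all $i$). Vertices of a simplicial complex are identified with indeterminates over the field $K$. A facet is a face that is maximal under inclusion; the dimension of a face $F$ is $|F|-1$. The facet ideal of a simplicial complex $\Gamma$ is the ideal $I(\Gamma)$, in the polynomial ring over $K$ whose indeterminates are the vertices of $\Gamma$, generated by all squarefree monomials $\prod_{v\in F}v$ with $F$ a facet of $\Gamma$. For a proper ideal $I$ of a Noetherian commutative ring $R$ with identity, the arithmetical rank $\operatorname{ara} I$ is the smallest integer $s$ for which there exist $a_1,\dots,a_s\in R$ with $\sqrt{(a_1,\dots,a_s)}=\sqrt{I}$. The height of $I$ is denoted $\operatorname{ht} I$. The ideal $I$ is called a set-theoretic complete intersection if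 $\operatorname{ara} I=\operatorname{ht} I$. *)

theory Defs
  imports
    "HOL-Algebra.Ideal"
    "HOL-Library.Poly_Mapping"
    "HOL-Library.Extended_Nat"
begin

text \<open>Finiteness of each face together with finiteness of the complex makes the vertex set finite.
  Vertices are read off from the faces, so every element of the vertex set is a vertex.\<close>

definition abstract_simplicial_complex :: "'v set set \<Rightarrow> bool" where
  "abstract_simplicial_complex \<Delta> \<longleftrightarrow>
     finite \<Delta> \<and> (\<forall>F\<in>\<Delta>. finite F) \<and> (\<forall>F\<in>\<Delta>. \<forall>G. G \<subseteq> F \<longrightarrow> G \<in> \<Delta>)"

definition complex_vertices :: "'v set set \<Rightarrow> 'v set" where
  "complex_vertices \<Delta> = {v. {v} \<in> \<Delta>}"

definition complex_facets :: "'v set set \<Rightarrow> 'v set set" where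
  "complex_facets \<Delta> = {F\<in>\<Delta>. \<forall>G\<in>\<Delta>. F \<subseteq> G \<longrightarrow> G = F}"

definition face_dim :: "'v set \<Rightarrow> int" where
  "face_dim F = int (card F) - 1"


text \<open>A polynomial is a finitely supported map from exponent vectors to coefficients.
  The ring \<open>K[V]\<close> consists of those polynomials in which only indeterminates from \<open>V\<close> occur;
  the type of indeterminates may be larger than \<open>V\<close>.\<close>

type_synonym ('v, 'k) mpolynomial = "('v \<Rightarrow>\<^sub>0 nat) \<Rightarrow>\<^sub>0 'k"

definition mpoly_ring :: "'v set \<Rightarrow> ('v, 'k::field) mpolynomial ring" where
  "mpoly_ring V =
     \<lparr>carrier = {p. \<forall>m\<in>Poly_Mapping.keys p. Poly_Mapping.keys m \<subseteq> V},
      monoid.mult = (*), one = 1, ring.zero = 0, add = (+)\<rparr>"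

definition mpoly_var :: "'v \<Rightarrow> ('v, 'k::field) mpolynomial" where
  "mpoly_var v = Poly_Mapping.single (Poly_Mapping.single v 1) 1"

definition facet_ideal :: "'v set set \<Rightarrow> ('v, 'k::field) mpolynomial set" where
  "facet_ideal \<Gamma> =
     genideal (mpoly_ring (complex_vertices \<Gamma>)) {(\<Prod>v\<in>F. mpoly_var v) | F. F \<in> complex_facets \<Gamma>}"


definition ideal_radical :: "('a, 'b) ring_scheme \<Rightarrow> 'a set \<Rightarrow> 'a set" where
  "ideal_radical R I = {a \<in> carrier R. \<exists>k::nat. a [^]\<^bsub>R\<^esub> k \<in> I}"

text \<open>Both invariants take values in \<^typ>\<open>enat\<close>, so that \<open>\<infinity>\<close> is returned, rather than an
  arbitrary number, when the infimum is over the empty set or the supremum is unbounded.\<close>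

definition arithmetical_rank :: "('a, 'b) ring_scheme \<Rightarrow> 'a set \<Rightarrow> enat" where
  "arithmetical_rank R I =
     Inf {enat s | s. \<exists>as. length as = s \<and> set as \<subseteq> carrier R \<and>
                          ideal_radical R (genideal R (set as)) = ideal_radical R I}"

definition prime_height :: "('a, 'b) ring_scheme \<Rightarrow> 'a set \<Rightarrow> enat" where
  "prime_height R P =
     Sup {enat l | l. \<exists>p::nat \<Rightarrow> 'a set. (\<forall>j\<le>l. primeideal (p j) R) \<and>
                          (\<forall>j<l. p j \<subset> p (Suc j)) \<and> p l = P}"

definition ideal_height :: "('a, 'b) ring_scheme \<Rightarrow> 'a set \<Rightarrow> enat" where
  "ideal_height R I = Inf {prime_height R P | P. primeideal P R \<and> I \<subseteq> P}"

definition set_theoretic_complete_intersection :: "('a, 'b) ring_scheme \<Rightarrow> 'a set \<Rightarrow> bool" where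
  "set_theoretic_complete_intersection R I \<longleftrightarrow>
     ideal I R \<and> I \<noteq> carrier R \<and> arithmetical_rank R I = ideal_height R I"


lemma mpoly_ring_simps [simp]:
  "carrier (mpoly_ring V) = {p. \<forall>m\<in>Poly_Mapping.keys p. Poly_Mapping.keys m \<subseteq> V}"
  "p \<otimes>\<^bsub>mpoly_ring V\<^esub> q = p * q" "\<one>\<^bsub>mpoly_ring V\<^esub> = 1"
  "p \<oplus>\<^bsub>mpoly_ring V\<^esub> q = p + q" "\<zero>\<^bsub>mpoly_ring V\<^esub> = 0"
  by (simp_all add: mpoly_ring_def)

lemma cring_mpoly_ring: "cring (mpoly_ring V :: ('v, 'k::field) mpolynomial ring)"
proof -
  let ?C = "{p :: ('v, 'k) mpolynomial. \<forall>m\<in>Poly_Mapping.keys p. Poly_Mapping.keys m \<subseteq> V}"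
  have add: "p + q \<in> ?C" if "p \<in> ?C" "q \<in> ?C" for p q
    using that Poly_Mapping.keys_add[of p q] by blast
  have mult: "p * q \<in> ?C" if "p \<in> ?C" "q \<in> ?C" for p q
  proof clarify
    fix m v assume m: "m \<in> Poly_Mapping.keys (p * q)" and v: "v \<in> Poly_Mapping.keys m"
    obtain a b where ab: "m = a + b" "a \<in> Poly_Mapping.keys p" "b \<in> Poly_Mapping.keys q"
      using m Poly_Mapping.keys_mult[of p q] by blast
    have "v \<in> Poly_Mapping.keys a \<union> Poly_Mapping.keys b"
      using v ab(1) Poly_Mapping.keys_add[of a b] by blast
    then show "v \<in> V" using ab that by blast
  qed
  have uminus: "- p \<in> ?C" if "p \<in> ?C" for p using that by simp
  show ?thesis
  proof (rule cringI)
    show "abelian_group (mpoly_ring V :: ('v, 'k) mpolynomial ring)"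
    proof (rule abelian_groupI)
      fix p q :: "('v, 'k) mpolynomial"
      assume "p \<in> carrier (mpoly_ring V)" "q \<in> carrier (mpoly_ring V)"
      then show "p \<oplus>\<^bsub>mpoly_ring V\<^esub> q \<in> carrier (mpoly_ring V)"
        unfolding mpoly_ring_simps by (rule add)
    next
      fix p :: "('v, 'k) mpolynomial" assume "p \<in> carrier (mpoly_ring V)"
      then have "- p \<in> carrier (mpoly_ring V)" unfolding mpoly_ring_simps by (rule uminus)
      then show "\<exists>q\<in>carrier (mpoly_ring V). q \<oplus>\<^bsub>mpoly_ring V\<^esub> p = \<zero>\<^bsub>mpoly_ring V\<^esub>"
        unfolding mpoly_ring_simps(4,5) by (rule rev_bexI) simp
    qed (simp_all add: add.assoc add.commute)
    show "Group.comm_monoid (mpoly_ring V :: ('v, 'k) mpolynomial ring)"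
    proof (rule comm_monoidI)
      fix p q :: "('v, 'k) mpolynomial"
      assume "p \<in> carrier (mpoly_ring V)" "q \<in> carrier (mpoly_ring V)"
      then show "p \<otimes>\<^bsub>mpoly_ring V\<^esub> q \<in> carrier (mpoly_ring V)"
        unfolding mpoly_ring_simps by (rule mult)
    qed (simp_all add: mult.assoc mult.commute)
  qed (simp add: distrib_right)
qed

end

theory Submission
  imports Defs
begin

text \<open>
  Write \<open>V\<close> for the vertex set of \<open>\<Delta>'\<close> and \<open>X = {x\<^sub>1, \<dots>, x\<^sub>n}\<close> for that of \<open>\<Delta>\<close>; every facet of
  \<open>\<Delta>'\<close> meets \<open>X\<close>, so \<open>I\<close> lies in the prime \<open>(X)\<close> generated by the \<open>x\<^sub>i\<close>.

  Height. A prime \<open>P \<supseteq> I\<close> contains the monomial of each \<open>F\<^sub>i\<close>, hence a vertex \<open>y\<^sub>i \<in> F\<^sub>i\<close>; these are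
  distinct because the \<open>F\<^sub>i\<close> are disjoint, and \<open>0 \<subset> (y\<^sub>1) \<subset> (y\<^sub>1, y\<^sub>2) \<subset> \<dots>\<close> is a chain of \<open>n\<close>
  steps below \<open>P\<close>. Conversely, the prime \<open>(X)\<close> has height at most \<open>n\<close>: a chain ending in it can be
  prolonged by adding the remaining \<open>|V| - n\<close> indeterminates one at a time, and no chain in
  \<open>K[V]\<close> has more than \<open>|V|\<close> steps (\<open>prime_chain_length_le_card\<close>). The last bound holds since
  elements picked from the successive differences of a chain cannot satisfy an algebraic relation
  over \<open>K\<close>, while more than \<open>|V|\<close> polynomials always do.

  Upper bound for the arithmetical rank. To each nonempty \<open>S \<subseteq> X\<close> attach a squarefree monomial
  \<open>m\<^sub>S\<close>: the product of \<open>S\<close> if \<open>S\<close> contains a facet of \<open>\<Delta>'\<close>, and the product of all \<open>F\<^sub>i\<close> with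
  \<open>x\<^sub>i \<in> S\<close> otherwise. All \<open>m\<^sub>S\<close> lie in \<open>I\<close>, they include its generators, and \<open>m\<^sub>S m\<^sub>T\<close> is divisible
  by \<open>m\<^bsub>S \<union> T\<^esub>\<close>. By the argument of Schmitt and Vogel (\<open>Schmitt_Vogel_subset_lattice\<close>) the \<open>n\<close>
  sums \<open>\<Sum>\<^bsub>|S| = k\<^esub> m\<^sub>S\<close> generate \<open>I\<close> up to radical.

  Lower bound for the arithmetical rank. Suppose \<open>a\<^sub>1, \<dots>, a\<^sub>s\<close> generate \<open>I\<close> up to radical. Setting
  all indeterminates outside \<open>X\<close> to 1 turns the monomial of \<open>F\<^sub>i\<close> into \<open>x\<^sub>i\<close>. So the images \<open>b\<^sub>j\<close> of
  the \<open>a\<^sub>j\<close> in \<open>K[X]\<close> have no constant term, but generate an ideal that contains a power of each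
  \<open>x\<^sub>i\<close>. Then \<open>n \<le> s\<close> by a comparison of growth rates (\<open>card_le_number_of_parameters\<close>): modulo the
  \<open>m\<close>-th power of the maximal ideal \<open>(X)\<close>, about \<open>m\<^sup>n\<close> monomials are independent, yet they are
  combinations of \<open>O(m\<^sup>s)\<close> elements, namely of products of a fixed finite set of monomials with
  monomials in the \<open>b\<^sub>j\<close>.
\<close>

section \<open>Polynomials in a given set of indeterminates\<close>

definition polys :: "'v set \<Rightarrow> ('v, 'k::field) mpolynomial set" where
  "polys V = {p. \<forall>m\<in>Poly_Mapping.keys p. Poly_Mapping.keys m \<subseteq> V}"

definition const :: "'k::field \<Rightarrow> ('v, 'k) mpolynomial" where
  "const c = Poly_Mapping.single 0 c"

lemma carrier_mpoly_ring: "carrier (mpoly_ring V) = polys V"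
  by (simp add: polys_def)

lemma polysD: "p \<in> polys V \<Longrightarrow> m \<in> Poly_Mapping.keys p \<Longrightarrow> Poly_Mapping.keys m \<subseteq> V"
  by (auto simp: polys_def)

lemma polys_zero [simp]: "0 \<in> polys V"
  and polys_one [simp]: "1 \<in> polys V"
  and polys_const [simp]: "const c \<in> polys V"
  by (auto simp: polys_def const_def)

lemma polys_add: "p \<in> polys V \<Longrightarrow> q \<in> polys V \<Longrightarrow> p + q \<in> polys V"
  using cring.cring_simprules(1)[OF cring_mpoly_ring, of p V q] by (simp add: polys_def)

lemma polys_mult: "p \<in> polys V \<Longrightarrow> q \<in> polys V \<Longrightarrow> p * q \<in> polys V"
  using cring.cring_simprules(5)[OF cring_mpoly_ring, of p V q] by (simp add: polys_def)

lemma polys_uminus: "p \<in> polys V \<Longrightarrow> - p \<in> polys V"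
  by (simp add: polys_def)

lemma polys_minus: "p \<in> polys V \<Longrightarrow> q \<in> polys V \<Longrightarrow> p - q \<in> polys V"
  using polys_add[of p V "- q"] polys_uminus[of q V] by simp

lemma polys_sum: "(\<And>i. i \<in> A \<Longrightarrow> f i \<in> polys V) \<Longrightarrow> sum f A \<in> polys V"
  by (induction A rule: infinite_finite_induct) (auto intro: polys_add)

lemma polys_prod: "(\<And>i. i \<in> A \<Longrightarrow> f i \<in> polys V) \<Longrightarrow> prod f A \<in> polys V"
  by (induction A rule: infinite_finite_induct) (auto intro: polys_mult)

lemma polys_power: "p \<in> polys V \<Longrightarrow> p ^ k \<in> polys V"
  by (induction k) (auto intro: polys_mult)

lemma polys_single: "Poly_Mapping.keys m \<subseteq> V \<Longrightarrow> Poly_Mapping.single m c \<in> polys V"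
  by (auto simp: polys_def)

lemma polys_var: "v \<in> V \<Longrightarrow> mpoly_var v \<in> polys V"
  by (auto simp: polys_def mpoly_var_def)

lemmas polys_intros = polys_zero polys_one polys_const polys_add polys_mult polys_uminus
  polys_minus polys_sum polys_prod polys_power polys_single polys_var

lemma mpoly_ring_pow: "a [^]\<^bsub>mpoly_ring V\<^esub> (k::nat) = a ^ k"
  by (induction k) (simp_all add: mult.commute)

lemma const_mult: "const a * const b = const (a * b)"
  by (simp add: const_def mult_single)

lemma const_add: "const a + const b = const (a + b)"
  by (simp add: const_def single_add)

lemma const_0 [simp]: "const 0 = 0" and const_1 [simp]: "const 1 = 1"
  by (simp_all add: const_def)

lemma const_sum: "const (sum f A) = (\<Sum>a\<in>A. const (f a))"
  by (induction A rule: infinite_finite_induct) (simp_all flip: const_add)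

lemma const_times_single: "const c * Poly_Mapping.single m d = Poly_Mapping.single m (c * d)"
  by (simp add: const_def mult_single)

lemma lookup_const_times: "Poly_Mapping.lookup (const c * p) m = c * Poly_Mapping.lookup p m"
  by (simp add: const_def mult_map_scale_conv_mult[symmetric] Poly_Mapping.map.rep_eq when_def)

lemma poly_eq_sum_monomials:
  "p = (\<Sum>m\<in>Poly_Mapping.keys p. Poly_Mapping.single m (Poly_Mapping.lookup p m))"
  by (rule poly_mapping_eqI) (auto simp: lookup_sum lookup_single when_def in_keys_iff)

section \<open>Substitution homomorphisms\<close>

text \<open>The product runs over the support only, which makes it finite for every exponent vector.\<close>
definition monom_value :: "('v \<Rightarrow> 'a::comm_ring_1) \<Rightarrow> ('v \<Rightarrow>\<^sub>0 nat) \<Rightarrow> 'a" where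
  "monom_value f m = (\<Prod>v\<in>Poly_Mapping.keys m. f v ^ Poly_Mapping.lookup m v)"

definition subst :: "('v \<Rightarrow> ('w, 'k::field) mpolynomial) \<Rightarrow> ('v, 'k) mpolynomial \<Rightarrow> ('w, 'k) mpolynomial"
  where "subst f p = (\<Sum>m\<in>Poly_Mapping.keys p. const (Poly_Mapping.lookup p m) * monom_value f m)"

lemma monom_value_superset:
  assumes "finite A" "Poly_Mapping.keys m \<subseteq> A"
  shows "monom_value f m = (\<Prod>v\<in>A. f v ^ Poly_Mapping.lookup m v)"
  unfolding monom_value_def
  by (rule prod.mono_neutral_left) (use assms in \<open>auto simp: in_keys_iff\<close>)

lemma monom_value_add: "monom_value f (m + m') = monom_value f m * monom_value f m'"
proof -
  let ?A = "Poly_Mapping.keys m \<union> Poly_Mapping.keys m'"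
  have "Poly_Mapping.keys (m + m') \<subseteq> ?A" using Poly_Mapping.keys_add[of m m'] by auto
  then have "monom_value f (m + m') = (\<Prod>v\<in>?A. f v ^ Poly_Mapping.lookup (m + m') v)"
    by (intro monom_value_superset) auto
  also have "\<dots> = (\<Prod>v\<in>?A. f v ^ Poly_Mapping.lookup m v) * (\<Prod>v\<in>?A. f v ^ Poly_Mapping.lookup m' v)"
    by (simp add: lookup_add power_add prod.distrib)
  finally show ?thesis by (simp add: monom_value_superset[of ?A])
qed

lemma monom_value_0 [simp]: "monom_value f 0 = 1"
  by (simp add: monom_value_def)

lemma monom_value_single: "monom_value f (Poly_Mapping.single v k) = f v ^ k"
  by (simp add: monom_value_def)

lemma subst_superset:
  assumes "finite A" "Poly_Mapping.keys p \<subseteq> A"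
  shows "subst f p = (\<Sum>m\<in>A. const (Poly_Mapping.lookup p m) * monom_value f m)"
  unfolding subst_def
  by (rule sum.mono_neutral_left) (use assms in \<open>auto simp: in_keys_iff\<close>)

lemma subst_0 [simp]: "subst f 0 = 0"
  by (simp add: subst_def)

lemma subst_add: "subst f (p + q) = subst f p + subst f q"
proof -
  let ?A = "Poly_Mapping.keys p \<union> Poly_Mapping.keys q"
  have "Poly_Mapping.keys (p + q) \<subseteq> ?A" using Poly_Mapping.keys_add[of p q] by auto
  then show ?thesis
    by (simp add: subst_superset[of ?A] lookup_add algebra_simps sum.distrib flip: const_add)
qed

lemma subst_sum: "subst f (sum g A) = (\<Sum>i\<in>A. subst f (g i))"
  by (induction A rule: infinite_finite_induct) (auto simp: subst_add)

lemma subst_single: "subst f (Poly_Mapping.single m c) = const c * monom_value f m"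
  by (simp add: subst_def)

lemma subst_const [simp]: "subst f (const c) = const c"
  using subst_single[of f 0 c] by (simp add: const_def)

lemma subst_1 [simp]: "subst f 1 = 1"
  using subst_const[of f 1] by simp

lemma subst_var [simp]: "subst f (mpoly_var v) = f v"
  by (simp add: mpoly_var_def subst_single monom_value_single)

text \<open>Both sides are biadditive, so it suffices to compare them on terms, where the claim is
  \<open>monom_value_add\<close>.\<close>
lemma subst_mult: "subst f (p * q) = subst f p * subst f q"
proof -
  let ?p = "\<lambda>m. Poly_Mapping.single m (Poly_Mapping.lookup p m)"
  let ?q = "\<lambda>m. Poly_Mapping.single m (Poly_Mapping.lookup q m)"
  have "p * q = (\<Sum>m\<in>Poly_Mapping.keys p. ?p m) * (\<Sum>m\<in>Poly_Mapping.keys q. ?q m)"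
    by (simp flip: poly_eq_sum_monomials)
  also have "\<dots> = (\<Sum>m\<in>Poly_Mapping.keys p. \<Sum>m'\<in>Poly_Mapping.keys q. ?p m * ?q m')"
    by (rule sum_product)
  finally have "subst f (p * q) =
      (\<Sum>m\<in>Poly_Mapping.keys p. \<Sum>m'\<in>Poly_Mapping.keys q. subst f (?p m * ?q m'))"
    by (simp add: subst_sum)
  also have "\<dots> = (\<Sum>m\<in>Poly_Mapping.keys p. \<Sum>m'\<in>Poly_Mapping.keys q. subst f (?p m) * subst f (?q m'))"
    by (intro sum.cong refl)
      (simp add: subst_single mult_single monom_value_add algebra_simps flip: const_mult)
  also have "\<dots> = subst f p * subst f q"
    by (simp add: sum_product subst_single subst_def[of f p] subst_def[of f q])
  finally show ?thesis .
qed

lemma subst_power: "subst f (p ^ k) = subst f p ^ k"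
  by (induction k) (auto simp: subst_mult)

lemma subst_prod: "subst f (prod g A) = (\<Prod>i\<in>A. subst f (g i))"
  by (induction A rule: infinite_finite_induct) (auto simp: subst_mult)

lemma subst_subst: "subst g (subst f p) = subst (\<lambda>v. subst g (f v)) p"
  unfolding subst_def[of f p] subst_def[of "\<lambda>v. subst g (f v)" p]
  by (simp add: subst_sum subst_mult monom_value_def subst_prod subst_power)

lemma monom_value_polys:
  assumes "\<And>v. v \<in> Poly_Mapping.keys m \<Longrightarrow> f v \<in> polys W"
  shows "monom_value f m \<in> polys W"
  unfolding monom_value_def by (intro polys_intros assms)

lemma subst_polys:
  assumes "p \<in> polys V" "\<And>v. v \<in> V \<Longrightarrow> f v \<in> polys W"
  shows "subst f p \<in> polys W"
  unfolding subst_def by (intro polys_intros monom_value_polys assms(2)) (use assms(1) polysD in blast)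

lemma var_power: "(mpoly_var v :: ('v, 'k::field) mpolynomial) ^ k = Poly_Mapping.single (Poly_Mapping.single v k) 1"
  by (induction k) (simp_all add: mpoly_var_def mult_single flip: single_add)

lemma monom_value_var: "monom_value mpoly_var m = Poly_Mapping.single m (1 :: 'k::field)"
proof -
  have "(\<Prod>v\<in>A. (mpoly_var v :: ('v, 'k::field) mpolynomial) ^ g v) =
      Poly_Mapping.single (\<Sum>v\<in>A. Poly_Mapping.single v (g v)) 1" if "finite A" for A and g :: "'v \<Rightarrow> nat"
    using that by induction (simp_all add: var_power mult_single)
  from this[OF finite_keys[of m], of "Poly_Mapping.lookup m"] show ?thesis
    unfolding monom_value_def by (simp flip: poly_eq_sum_monomials)
qed

section \<open>Ideals generated by indeterminates\<close>

text \<open>The ideal of \<open>K[V]\<close> generated by \<open>S \<inter> V\<close>, given by its monomials: an element belongs to it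
  iff each of its monomials is divisible by an indeterminate from \<open>S\<close>. That this is the ideal
  generated by indeterminates is \<open>var_ideal_subset\<close> together with \<open>var_in_var_ideal_iff\<close>.\<close>
definition var_ideal :: "'v set \<Rightarrow> 'v set \<Rightarrow> ('v, 'k::field) mpolynomial set" where
  "var_ideal V S = {p \<in> polys V. \<forall>m\<in>Poly_Mapping.keys p. Poly_Mapping.keys m \<inter> S \<noteq> {}}"

lemma ideal_mpoly_ring_iff:
  fixes J :: "('v, 'k::field) mpolynomial set"
  shows "ideal J (mpoly_ring V) \<longleftrightarrow> J \<subseteq> polys V \<and> 0 \<in> J \<and> (\<forall>a\<in>J. \<forall>b\<in>J. a + b \<in> J) \<and>
     (\<forall>a\<in>J. \<forall>r\<in>polys V. r * a \<in> J)" (is "?L \<longleftrightarrow> ?R")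
proof
  assume ?L
  then interpret ideal J "mpoly_ring V" .
  show ?R
    using a_subset additive_subgroup.zero_closed[OF is_additive_subgroup]
      additive_subgroup.a_closed[OF is_additive_subgroup] I_l_closed
    by (auto simp: carrier_mpoly_ring simp del: mpoly_ring_simps(1))
next
  assume R: ?R
  interpret cring "mpoly_ring V :: ('v, 'k) mpolynomial ring" by (rule cring_mpoly_ring)
  have neg: "- a \<in> J" if "a \<in> J" for a
  proof -
    have "(- 1) * a \<in> J" using R that polys_uminus[OF polys_one, of V] by blast
    then show ?thesis by simp
  qed
  have inv: "inv\<^bsub>add_monoid (mpoly_ring V)\<^esub> a = - a" if "a \<in> J" for a
  proof -
    have "a \<in> polys V" using that R by blast
    then show ?thesis
      using minus_equality[of "- a" a] polys_uminus[of a V]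
      by (simp add: a_inv_def carrier_mpoly_ring del: mpoly_ring_simps(1)) 
  qed
  show ?L
  proof (rule idealI)
    show "ring (mpoly_ring V :: ('v, 'k) mpolynomial ring)" by (rule ring_axioms)
    show "subgroup J (add_monoid (mpoly_ring V))"
      by (rule group.subgroupI[OF a_group]) (use R neg inv in \<open>auto simp: polys_def\<close>)
  qed (use R in \<open>auto simp: polys_def mult.commute\<close>)
qed

lemma primeideal_mpoly_ring_iff:
  "primeideal J (mpoly_ring V) \<longleftrightarrow> ideal J (mpoly_ring V) \<and> 1 \<notin> J \<and>
     (\<forall>a\<in>polys V. \<forall>b\<in>polys V. a * b \<in> J \<longrightarrow> a \<in> J \<or> b \<in> J)" (is "?L \<longleftrightarrow> ?R")
proof
  assume ?L
  then interpret primeideal J "mpoly_ring V" .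
  show ?R using ideal_axioms I_prime I_notcarr one_imp_carrier
    by (auto simp: carrier_mpoly_ring simp del: mpoly_ring_simps(1))
next
  assume R: ?R
  show ?L
    by (rule primeidealI) (use R in \<open>auto simp: cring_mpoly_ring carrier_mpoly_ring simp del: mpoly_ring_simps(1)\<close>)
qed

lemma ideal_sum:
  assumes "ideal J (mpoly_ring V)" "\<And>i. i \<in> A \<Longrightarrow> f i \<in> J"
  shows "sum f A \<in> J"
  using assms by (induction A rule: infinite_finite_induct) (auto simp: ideal_mpoly_ring_iff)

lemma ideal_var_ideal: "ideal (var_ideal V S :: ('v, 'k::field) mpolynomial set) (mpoly_ring V)"
proof -
  have "p + q \<in> var_ideal V S" if "p \<in> var_ideal V S" "q \<in> var_ideal V S" for p q :: "('v, 'k) mpolynomial"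
    using that Poly_Mapping.keys_add[of p q] by (auto simp: var_ideal_def intro: polys_add)
  moreover have "r * p \<in> var_ideal V S" if "p \<in> var_ideal V S" "r \<in> polys V" for r p :: "('v, 'k) mpolynomial"
  proof -
    have "Poly_Mapping.keys m \<inter> S \<noteq> {}" if m: "m \<in> Poly_Mapping.keys (r * p)" for m
    proof -
      from m obtain a b where ab: "m = a + b" "b \<in> Poly_Mapping.keys p"
        using Poly_Mapping.keys_mult[of r p] by blast
      then obtain v where v: "v \<in> Poly_Mapping.keys b" "v \<in> S" using \<open>p \<in> var_ideal V S\<close> by (auto simp: var_ideal_def)
      have "v \<in> Poly_Mapping.keys m" using v by (simp add: ab in_keys_iff lookup_add)
      then show ?thesis using v by blast
    qed
    then show ?thesis using that by (auto simp: var_ideal_def intro: polys_mult)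
  qed
  moreover have "var_ideal V S \<subseteq> polys V" "0 \<in> var_ideal V S" by (auto simp: var_ideal_def)
  ultimately show ?thesis unfolding ideal_mpoly_ring_iff by blast
qed

lemma var_in_var_ideal_iff: "mpoly_var v \<in> var_ideal V S \<longleftrightarrow> v \<in> V \<and> v \<in> S"
  by (auto simp: var_ideal_def mpoly_var_def polys_def)

lemma var_ideal_mono: "S \<subseteq> T \<Longrightarrow> var_ideal V S \<subseteq> var_ideal V T"
  by (auto simp: var_ideal_def)

text \<open>Each term of an element of \<open>(S)\<close> is a multiple of an indeterminate that belongs to \<open>J\<close>.\<close>
lemma var_ideal_subset:
  fixes J :: "('v, 'k::field) mpolynomial set"
  assumes J: "ideal J (mpoly_ring V)" and S: "\<And>v. v \<in> S \<inter> V \<Longrightarrow> mpoly_var v \<in> J"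
  shows "var_ideal V S \<subseteq> J"
proof
  fix p :: "('v, 'k) mpolynomial" assume p: "p \<in> var_ideal V S"
  have "Poly_Mapping.single m c \<in> J" if m: "m \<in> Poly_Mapping.keys p" for m and c :: 'k
  proof -
    have mV: "Poly_Mapping.keys m \<subseteq> V" using p m by (auto simp: var_ideal_def dest: polysD)
    from p m obtain v where v: "v \<in> Poly_Mapping.keys m" "v \<in> S" by (auto simp: var_ideal_def)
    define r where "r = m - Poly_Mapping.single v 1"
    have mr: "m = r + Poly_Mapping.single v 1"
      by (rule poly_mapping_eqI) (use v in \<open>auto simp: r_def lookup_add lookup_minus lookup_single when_def in_keys_iff\<close>)
    have "Poly_Mapping.keys r \<subseteq> Poly_Mapping.keys m" by (auto simp: mr in_keys_iff lookup_add)
    then have "Poly_Mapping.single r c \<in> polys V" using mV by (intro polys_single) auto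
    moreover have "mpoly_var v \<in> J" using v mV S by blast
    moreover have "Poly_Mapping.single m c = Poly_Mapping.single r c * mpoly_var v"
      by (simp add: mpoly_var_def mult_single mr)
    ultimately show ?thesis using J by (simp add: ideal_mpoly_ring_iff)
  qed
  then show "p \<in> J" by (subst poly_eq_sum_monomials) (intro ideal_sum[OF J], simp)
qed

text \<open>The ideal is the kernel of a homomorphism into an integral domain: set the indeterminates in
  \<open>S\<close> to zero and rename the others injectively to natural numbers. The renaming provides
  a linear order of the indeterminates, hence a monomial order, from which the absence of zero
  divisors follows.\<close>
lemma primeideal_var_ideal:
  assumes "finite V"
  shows "primeideal (var_ideal V S :: ('v, 'k::field) mpolynomial set) (mpoly_ring V)"
proof -
  obtain e :: "'v \<Rightarrow> nat" where e: "inj_on e V"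
    using finite_imp_inj_to_nat_seg[OF assms] by blast
  define f :: "'v \<Rightarrow> (nat, 'k) mpolynomial"
    where "f v = (if v \<in> S \<or> v \<notin> V then 0 else mpoly_var (e v))" for v
  define h :: "'v \<Rightarrow> ('v, 'k) mpolynomial"
    where "h v = (if v \<in> S \<or> v \<notin> V then 0 else mpoly_var v)" for v
  \<comment> \<open>Undoing the renaming: \<open>f\<close> followed by the inverse renaming is \<open>h\<close>, which deletes exactly
    the terms that meet \<open>S\<close>.\<close>
  have h: "subst (\<lambda>w. mpoly_var (inv_into V e w)) (f v) = h v" for v
    using e by (simp add: f_def h_def)
  have kill: "monom_value g m = 0" if "Poly_Mapping.keys m \<inter> S \<noteq> {}" "\<And>v. v \<in> S \<Longrightarrow> g v = 0"
    for m and g :: "'v \<Rightarrow> ('x, 'k) mpolynomial"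
  proof -
    from that(1) obtain v where v: "v \<in> Poly_Mapping.keys m" "v \<in> S" by blast
    then have "g v ^ Poly_Mapping.lookup m v = 0" by (simp add: that(2) in_keys_iff zero_power)
    with v(1) show ?thesis unfolding monom_value_def by (intro prod_zero[OF finite_keys] bexI[of _ v])
  qed
  have kernel: "p \<in> var_ideal V S \<longleftrightarrow> subst f p = 0" if p: "p \<in> polys V" for p
  proof
    assume p': "p \<in> var_ideal V S"
    have "monom_value f m = 0" if "m \<in> Poly_Mapping.keys p" for m
      by (rule kill) (use p' that in \<open>auto simp: var_ideal_def f_def\<close>)
    then show "subst f p = 0" by (simp add: subst_def)
  next
    assume 0: "subst f p = 0"
    have h0: "subst h p = 0"
      using subst_subst[of "\<lambda>w. mpoly_var (inv_into V e w)" f p] unfolding 0 h subst_0 by (rule sym)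
    have lookup_h: "Poly_Mapping.lookup (subst h p) m = Poly_Mapping.lookup p m"
      if m: "m \<in> Poly_Mapping.keys p" "Poly_Mapping.keys m \<inter> S = {}" for m
    proof -
      have val: "monom_value h m' = (if Poly_Mapping.keys m' \<inter> S = {} then Poly_Mapping.single m' 1 else 0)"
        if "m' \<in> Poly_Mapping.keys p" for m'
      proof (cases "Poly_Mapping.keys m' \<inter> S = {}")
        case True
        have "monom_value h m' = monom_value mpoly_var m'"
          unfolding monom_value_def
          by (rule prod.cong) (use True polysD[OF p that] in \<open>auto simp: h_def\<close>)
        then show ?thesis using True by (simp add: monom_value_var)
      next
        case False
        then have "monom_value h m' = 0" by (rule kill) (simp add: h_def)
        then show ?thesis using False by simp
      qed
      have "Poly_Mapping.lookup (subst h p) m = (\<Sum>m'\<in>Poly_Mapping.keys p. if m' = m then Poly_Mapping.lookup p m else 0)"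
        unfolding subst_def lookup_sum
        by (rule sum.cong) (use m in \<open>auto simp: val lookup_const_times lookup_single when_def\<close>)
      then show ?thesis using m by simp
    qed
    have "Poly_Mapping.keys m \<inter> S \<noteq> {}" if m: "m \<in> Poly_Mapping.keys p" for m
      using lookup_h[OF m] m by (auto simp: h0 in_keys_iff)
    with p show "p \<in> var_ideal V S" by (simp add: var_ideal_def)
  qed
  have "(1 :: ('v, 'k) mpolynomial) \<notin> var_ideal V S" by (simp add: var_ideal_def)
  moreover have "a \<in> var_ideal V S \<or> b \<in> var_ideal V S"
    if "a \<in> polys V" "b \<in> polys V" "a * b \<in> var_ideal V S" for a b :: "('v, 'k) mpolynomial"
    using that by (simp add: kernel polys_mult subst_mult)
  ultimately show ?thesis by (simp add: primeideal_mpoly_ring_iff ideal_var_ideal)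
qed

section \<open>Linear systems and algebraic dependence\<close>

text \<open>Gaussian elimination of one equation at a time, solving for the unknown \<open>a0\<close> at a pivot.\<close>
lemma underdetermined_system_solution:
  fixes c :: "'a \<Rightarrow> 'j \<Rightarrow> 'k::field"
  assumes "finite J" "finite A" "card J < card A"
  shows "\<exists>l. (\<exists>a\<in>A. l a \<noteq> 0) \<and> (\<forall>j\<in>J. (\<Sum>a\<in>A. l a * c a j) = 0)"
  using assms
proof (induction J arbitrary: A c rule: finite_induct)
  case empty
  then have "A \<noteq> {}" by auto
  then show ?case by (intro exI[of _ "\<lambda>_. 1"]) auto
next
  case (insert j J)
  show ?case
  proof (cases "\<forall>a\<in>A. c a j = 0")
    case True
    from insert.IH[of A c] insert.prems insert.hyps obtain l
      where "\<exists>a\<in>A. l a \<noteq> 0" "\<forall>j\<in>J. (\<Sum>a\<in>A. l a * c a j) = 0" by auto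
    then show ?thesis using True by (intro exI[of _ l]) auto
  next
    case False
    then obtain a0 where a0: "a0 \<in> A" "c a0 j \<noteq> 0" by blast
    define A' where "A' = A - {a0}"
    define c' where "c' a i = c a i - c a j / c a0 j * c a0 i" for a i
    have A': "finite A'" "a0 \<notin> A'" "A = insert a0 A'" using a0 insert.prems by (auto simp: A'_def)
    have "card J < card A'" using insert.prems insert.hyps a0 by (simp add: A'_def card_Diff_singleton)
    from insert.IH[OF A'(1) this, of c'] obtain l where
      l: "\<exists>a\<in>A'. l a \<noteq> 0" "\<forall>i\<in>J. (\<Sum>a\<in>A'. l a * c' a i) = 0" by blast
    define s where "s = (\<Sum>a\<in>A'. l a * (c a j / c a0 j))"
    define l' where "l' = l(a0 := - s)"
    have sum: "(\<Sum>a\<in>A. l' a * c a i) = (\<Sum>a\<in>A'. l a * c' a i)" for i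
    proof -
      have "(\<Sum>a\<in>A. l' a * c a i) = - s * c a0 i + (\<Sum>a\<in>A'. l a * c a i)"
        using A' by (simp add: l'_def) (intro sum.cong, auto)
      also have "\<dots> = (\<Sum>a\<in>A'. l a * c' a i)"
        unfolding s_def c'_def by (simp add: sum_distrib_right sum_subtractf right_diff_distrib mult.assoc)
      finally show ?thesis .
    qed
    have "c' a j = 0" for a using a0 by (simp add: c'_def)
    then have "\<forall>i\<in>insert j J. (\<Sum>a\<in>A. l' a * c a i) = 0" using l(2) by (simp add: sum)
    moreover have "\<exists>a\<in>A. l' a \<noteq> 0" using l(1) A' by (auto simp: l'_def)
    ultimately show ?thesis by blast
  qed
qed

definition exponent_box :: "'v set \<Rightarrow> nat \<Rightarrow> ('v \<Rightarrow>\<^sub>0 nat) set" where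
  "exponent_box V d = {m. Poly_Mapping.keys m \<subseteq> V \<and> (\<forall>v. Poly_Mapping.lookup m v \<le> d)}"

lemma exponent_box_mono: "d \<le> e \<Longrightarrow> exponent_box V d \<subseteq> exponent_box V e"
  by (auto simp: exponent_box_def intro: order_trans)

lemma
  assumes "finite V"
  shows finite_exponent_box: "finite (exponent_box V d)"
    and card_exponent_box: "card (exponent_box V d) \<le> (d + 1) ^ card V"
proof -
  let ?f = "\<lambda>m. restrict (Poly_Mapping.lookup m) V"
  have inj: "inj_on ?f (exponent_box V d)"
  proof (rule inj_onI)
    fix m m' assume mm: "m \<in> exponent_box V d" "m' \<in> exponent_box V d" and eq: "?f m = ?f m'"
    show "m = m'"
    proof (rule poly_mapping_eqI)
      fix v
      show "Poly_Mapping.lookup m v = Poly_Mapping.lookup m' v"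
      proof (cases "v \<in> V")
        case True
        then show ?thesis using fun_cong[OF eq, of v] by simp
      next
        case False
        then show ?thesis using mm by (metis (mono_tags, lifting) exponent_box_def in_keys_iff mem_Collect_eq subsetD)
      qed
    qed
  qed
  have sub: "?f ` exponent_box V d \<subseteq> PiE V (\<lambda>_. {..d})"
    by (auto simp: exponent_box_def PiE_def)
  have fin: "finite (PiE V (\<lambda>_. {..d}))" using assms by (intro finite_PiE) auto
  show "finite (exponent_box V d)" by (rule inj_on_finite[OF inj sub fin])
  have "card (exponent_box V d) \<le> card (PiE V (\<lambda>_. {..d}))" by (rule card_inj_on_le[OF inj sub fin])
  then show "card (exponent_box V d) \<le> (d + 1) ^ card V" using assms by (simp add: card_PiE)
qed

lemma keys_mult_exponent_box:
  assumes "Poly_Mapping.keys p \<subseteq> exponent_box V d" "Poly_Mapping.keys q \<subseteq> exponent_box V e"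
  shows "Poly_Mapping.keys (p * q) \<subseteq> exponent_box V (d + e)"
proof
  fix m assume "m \<in> Poly_Mapping.keys (p * q)"
  then obtain a b where ab: "m = a + b" "a \<in> Poly_Mapping.keys p" "b \<in> Poly_Mapping.keys q"
    using Poly_Mapping.keys_mult[of p q] by blast
  have "a \<in> exponent_box V d" "b \<in> exponent_box V e" using ab assms by auto
  then show "m \<in> exponent_box V (d + e)" using Poly_Mapping.keys_add[of a b]
    unfolding exponent_box_def ab(1) by (auto simp: lookup_add add_mono)
qed

lemma keys_power_exponent_box:
  assumes "Poly_Mapping.keys p \<subseteq> exponent_box V d"
  shows "Poly_Mapping.keys (p ^ k) \<subseteq> exponent_box V (k * d)"
proof (induction k)
  case (Suc k)
  then show ?case using keys_mult_exponent_box[OF assms Suc] by simp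
qed (simp add: exponent_box_def)

lemma keys_prod_exponent_box:
  assumes "\<And>i. i \<in> A \<Longrightarrow> Poly_Mapping.keys (f i) \<subseteq> exponent_box V (d i)"
  shows "Poly_Mapping.keys (prod f A) \<subseteq> exponent_box V (sum d A)"
  using assms
proof (induction A rule: infinite_finite_induct)
  case (insert i A)
  then show ?case using keys_mult_exponent_box[of "f i" V "d i" "prod f A" "sum d A"] by auto
qed (auto simp: exponent_box_def)

lemma keys_in_exponent_box:
  assumes "p \<in> polys V"
  obtains d where "Poly_Mapping.keys p \<subseteq> exponent_box V d"
proof -
  define d where "d = (\<Sum>m\<in>Poly_Mapping.keys p. \<Sum>v\<in>Poly_Mapping.keys m. Poly_Mapping.lookup m v)"
  have "Poly_Mapping.lookup m v \<le> d" if m: "m \<in> Poly_Mapping.keys p" for m v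
  proof (cases "v \<in> Poly_Mapping.keys m")
    case True
    then have "Poly_Mapping.lookup m v \<le> (\<Sum>v\<in>Poly_Mapping.keys m. Poly_Mapping.lookup m v)"
      by (intro member_le_sum) auto
    also have "\<dots> \<le> d" unfolding d_def
      using member_le_sum[of m "Poly_Mapping.keys p" "\<lambda>m. \<Sum>v\<in>Poly_Mapping.keys m. Poly_Mapping.lookup m v"] m
      by auto
    finally show ?thesis .
  qed (simp add: in_keys_iff)
  then have "Poly_Mapping.keys p \<subseteq> exponent_box V d" using assms by (auto simp: exponent_box_def dest: polysD)
  then show ?thesis by (rule that)
qed

text \<open>The relation is delivered as a nonempty set \<open>B\<close> of exponent vectors with nonzero coefficients.
  There are \<open>m\<^sup>L\<close> monomials in the \<open>a\<^sub>i\<close> with exponents below \<open>m\<close>. The exponents of their expansions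
  are at most \<open>m D\<close>, so they lie in a space of dimension at most \<open>(m D + 1)\<^bsup>|V|\<^esup>\<close>, which is smaller
  than \<open>m\<^sup>L\<close> for large \<open>m\<close> as \<open>L > |V|\<close>.\<close>
lemma algebraic_dependence:
  fixes a :: "nat \<Rightarrow> ('v, 'k::field) mpolynomial"
  assumes V: "finite V" and L: "card V < L" and a: "\<And>i. i < L \<Longrightarrow> a i \<in> polys V"
  obtains B and l :: "(nat \<Rightarrow> nat) \<Rightarrow> 'k" where "finite B" "B \<noteq> {}" "B \<subseteq> extensional {..<L}"
    "\<forall>\<beta>\<in>B. l \<beta> \<noteq> 0" "(\<Sum>\<beta>\<in>B. const (l \<beta>) * (\<Prod>i<L. a i ^ \<beta> i)) = 0"
proof -
  define d where "d i = (SOME d. Poly_Mapping.keys (a i) \<subseteq> exponent_box V d)" for i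
  have d: "Poly_Mapping.keys (a i) \<subseteq> exponent_box V (d i)" if "i < L" for i
    unfolding d_def by (rule keys_in_exponent_box[OF a[OF that]]) (rule someI)
  define D where "D = (\<Sum>i<L. d i)"
  \<comment> \<open>Large enough for \<open>(m (D + 1))\<^bsup>|V|\<^esup> < m\<^bsup>|V| + 1\<^esup>\<close>.\<close>
  define m where "m = (D + 1) ^ card V + 1"
  define P where "P = PiE {..<L} (\<lambda>_. {..<m})"
  define f where "f \<beta> = (\<Prod>i<L. a i ^ \<beta> i)" for \<beta>
  have P: "finite P" "card P = m ^ L" "P \<subseteq> extensional {..<L}"
    unfolding P_def by (intro finite_PiE, simp, simp, simp add: card_PiE, simp add: PiE_def)
  have keys: "Poly_Mapping.keys (f \<beta>) \<subseteq> exponent_box V (m * D)" if "\<beta> \<in> P" for \<beta>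
  proof -
    have "Poly_Mapping.keys (f \<beta>) \<subseteq> exponent_box V (\<Sum>i<L. \<beta> i * d i)"
      unfolding f_def by (intro keys_prod_exponent_box keys_power_exponent_box d) simp
    moreover have "\<beta> i \<le> m" if "i < L" for i
      using PiE_mem[OF \<open>\<beta> \<in> P\<close>[unfolded P_def], of i] that by simp
    then have "(\<Sum>i<L. \<beta> i * d i) \<le> m * D"
      unfolding D_def sum_distrib_left by (intro sum_mono mult_right_mono) simp_all
    ultimately show ?thesis using exponent_box_mono by blast
  qed
  have m0: "m \<ge> 1" by (simp add: m_def)
  have "card (exponent_box V (m * D)) \<le> (m * D + 1) ^ card V" by (rule card_exponent_box[OF V])
  also have "\<dots> \<le> (m * (D + 1)) ^ card V" using m0 by (intro power_mono) auto
  also have "\<dots> = m ^ card V * (D + 1) ^ card V" by (simp only: power_mult_distrib)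
  also have "\<dots> < m ^ card V * m" using m0 by (simp add: m_def)
  also have "\<dots> = m ^ (card V + 1)" by simp
  also have "\<dots> \<le> m ^ L" using L m0 by (intro power_increasing) auto
  finally have "card (exponent_box V (m * D)) < card P" by (simp add: P)
  from underdetermined_system_solution[OF finite_exponent_box[OF V] P(1) this, of "\<lambda>\<beta>. Poly_Mapping.lookup (f \<beta>)"]
  obtain l where l: "\<exists>\<beta>\<in>P. l \<beta> \<noteq> 0"
      "\<forall>e\<in>exponent_box V (m * D). (\<Sum>\<beta>\<in>P. l \<beta> * Poly_Mapping.lookup (f \<beta>) e) = 0" by blast
  define B where "B = {\<beta>\<in>P. l \<beta> \<noteq> 0}"
  have "(\<Sum>\<beta>\<in>P. const (l \<beta>) * f \<beta>) = 0"
  proof (rule poly_mapping_eqI)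
    fix e
    have "(\<Sum>\<beta>\<in>P. l \<beta> * Poly_Mapping.lookup (f \<beta>) e) = 0"
    proof (cases "e \<in> exponent_box V (m * D)")
      case False
      then have "Poly_Mapping.lookup (f \<beta>) e = 0" if "\<beta> \<in> P" for \<beta>
        using keys[OF that] by (auto simp: in_keys_iff)
      then show ?thesis by simp
    qed (use l in blast)
    then show "Poly_Mapping.lookup (\<Sum>\<beta>\<in>P. const (l \<beta>) * f \<beta>) e = Poly_Mapping.lookup 0 e"
      by (simp add: lookup_sum lookup_const_times)
  qed
  moreover have "(\<Sum>\<beta>\<in>B. const (l \<beta>) * f \<beta>) = (\<Sum>\<beta>\<in>P. const (l \<beta>) * f \<beta>)"
    unfolding B_def by (rule sum.mono_neutral_left) (use P in auto)
  ultimately have "(\<Sum>\<beta>\<in>B. const (l \<beta>) * (\<Prod>i<L. a i ^ \<beta> i)) = 0" by (simp add: f_def)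
  moreover have "B \<noteq> {}" using l(1) by (auto simp: B_def)
  moreover have "finite B" "B \<subseteq> extensional {..<L}" "\<forall>\<beta>\<in>B. l \<beta> \<noteq> 0"
    using P by (auto simp: B_def)
  ultimately show ?thesis using that by blast
qed

section \<open>Heights of prime ideals\<close>

lemma ideal_minus:
  assumes J: "ideal J (mpoly_ring V)" and "a \<in> J" "b \<in> J"
  shows "a - b \<in> J"
proof -
  have "(- 1) * b \<in> J" using assms polys_uminus[OF polys_one, of V] unfolding ideal_mpoly_ring_iff by blast
  then have "a + (- 1) * b \<in> J" using assms unfolding ideal_mpoly_ring_iff by blast
  then show ?thesis by simp
qed

lemma primeideal_power:
  assumes "primeideal J (mpoly_ring V)" "a \<in> polys V" "a ^ k \<in> J"
  shows "a \<in> J"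
  using assms(3) by (induction k) (use assms(1,2) polys_power[OF assms(2)] in \<open>auto simp: primeideal_mpoly_ring_iff\<close>)

text \<open>Downward induction on \<open>j\<close>. Let \<open>t\<close> be the least exponent of \<open>a\<^sub>j\<close> in a relation modulo \<open>p\<^sub>j\<close>.
  As \<open>p\<^sub>j\<close> is prime and \<open>a\<^sub>j \<notin> p\<^sub>j\<close>, the power \<open>a\<^sub>j\<^sup>t\<close> may be cancelled; as \<open>a\<^sub>j\<close> belongs to the next
  prime, modulo that prime only the terms remain in which \<open>a\<^sub>j\<close> had exponent exactly \<open>t\<close>. They
  form a shorter relation. At the top, a nonzero constant would lie in a proper ideal. The last
  assumption says that the terms differ only in the exponents from \<open>j\<close> on, so that no two of them
  can merge.\<close>
lemma no_relation_along_chain: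
  fixes l :: "(nat \<Rightarrow> nat) \<Rightarrow> 'k::field"
  assumes prime: "\<And>j. j \<le> L \<Longrightarrow> primeideal (p j) (mpoly_ring V)"
    and chain: "\<And>j. j < L \<Longrightarrow> p j \<subseteq> p (Suc j)"
    and a: "\<And>j. j < L \<Longrightarrow> a j \<in> p (Suc j) - p j"
    and "j \<le> L"
    and "finite B" "B \<noteq> {}" "B \<subseteq> extensional {..<L}"
    and "\<And>\<beta>. \<beta> \<in> B \<Longrightarrow> l \<beta> \<noteq> 0"
    and "\<And>\<beta> \<gamma> i. \<beta> \<in> B \<Longrightarrow> \<gamma> \<in> B \<Longrightarrow> i < j \<Longrightarrow> \<beta> i = \<gamma> i"
  shows "(\<Sum>\<beta>\<in>B. const (l \<beta>) * (\<Prod>i\<in>{j..<L}. a i ^ \<beta> i)) \<notin> p j"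
  using assms(4-)
proof (induction j arbitrary: B rule: inc_induct)
  case base
  obtain \<beta> where \<beta>: "\<beta> \<in> B" using base by blast
  have "B = {\<beta>}"
  proof (rule antisym, rule subsetI)
    fix \<gamma> assume g: "\<gamma> \<in> B"
    have "\<gamma> = \<beta>"
      by (rule extensionalityI[of _ "{..<L}"]) (use g \<beta> base in auto)
    then show "\<gamma> \<in> {\<beta>}" by simp
  qed (use \<beta> in simp)
  have l: "const (inverse (l \<beta>)) * const (l \<beta>) = (1 :: (_, 'k) mpolynomial)"
    using base(4)[OF \<beta>] by (simp add: const_mult)
  show ?case
  proof
    assume "(\<Sum>\<beta>\<in>B. const (l \<beta>) * (\<Prod>i\<in>{L..<L}. a i ^ \<beta> i)) \<in> p L"
    then have "const (l \<beta>) \<in> p L" using \<open>B = {\<beta>}\<close> by simp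
    then have "1 \<in> p L" using prime[of L] l unfolding primeideal_mpoly_ring_iff ideal_mpoly_ring_iff
      by (metis order_refl polys_const)
    then show False using prime[of L] by (auto simp: primeideal_mpoly_ring_iff)
  qed
next
  case (step j)
  have pj: "primeideal (p j) (mpoly_ring V)" and pj': "ideal (p (Suc j)) (mpoly_ring V)"
    using prime[of j] prime[of "Suc j"] step.hyps by (auto simp: primeideal_mpoly_ring_iff)
  have poly: "a i \<in> polys V" if "i < L" for i
    using a[OF that] prime[of "Suc i"] that by (auto simp: primeideal_mpoly_ring_iff ideal_mpoly_ring_iff)
  define t where "t = Min ((\<lambda>\<beta>. \<beta> j) ` B)"
  define B0 where "B0 = {\<beta>\<in>B. \<beta> j = t}"
  have t: "t \<le> \<beta> j" if "\<beta> \<in> B" for \<beta> using that step.prems by (auto simp: t_def)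
  have "t \<in> (\<lambda>\<beta>. \<beta> j) ` B" unfolding t_def by (rule Min_in) (use step.prems(1,2) in auto)
  then have B0: "B0 \<noteq> {}" "B0 \<subseteq> B" by (auto simp: B0_def)
  define tail where "tail \<beta> = (\<Prod>i\<in>{Suc j..<L}. a i ^ \<beta> i)" for \<beta>
  have tail: "tail \<beta> \<in> polys V" for \<beta> unfolding tail_def by (intro polys_intros poly) simp
  define Q where "Q = (\<Sum>\<beta>\<in>B. const (l \<beta>) * (a j ^ (\<beta> j - t) * tail \<beta>))"
  have split: "(\<Prod>i\<in>{j..<L}. a i ^ \<beta> i) = a j ^ t * (a j ^ (\<beta> j - t) * tail \<beta>)" if "\<beta> \<in> B" for \<beta>
  proof -
    have "(\<Prod>i\<in>{j..<L}. a i ^ \<beta> i) = a j ^ \<beta> j * tail \<beta>"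
      using step.hyps by (simp add: tail_def prod.atLeast_Suc_lessThan)
    also have "a j ^ \<beta> j = a j ^ t * a j ^ (\<beta> j - t)" using t[OF that] by (simp flip: power_add)
    finally show ?thesis by (simp add: mult.assoc)
  qed
  show ?case
  proof
    assume "(\<Sum>\<beta>\<in>B. const (l \<beta>) * (\<Prod>i\<in>{j..<L}. a i ^ \<beta> i)) \<in> p j"
    also have "(\<Sum>\<beta>\<in>B. const (l \<beta>) * (\<Prod>i\<in>{j..<L}. a i ^ \<beta> i)) = a j ^ t * Q"
      unfolding Q_def sum_distrib_left by (intro sum.cong refl) (simp add: split mult_ac)
    finally have prod: "a j ^ t * Q \<in> p j" .
    have Qp: "Q \<in> polys V" unfolding Q_def by (intro polys_intros poly tail) (rule step.hyps)
    have "a j ^ t \<notin> p j" using primeideal_power[OF pj poly] a step.hyps by auto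
    then have "Q \<in> p j" using prod pj Qp polys_power[OF poly, of j t] step.hyps
      unfolding primeideal_mpoly_ring_iff by blast
    then have Q1: "Q \<in> p (Suc j)" using chain step.hyps by blast
    have Q2: "(\<Sum>\<beta>\<in>B - B0. const (l \<beta>) * (a j ^ (\<beta> j - t) * tail \<beta>)) \<in> p (Suc j)"
    proof (rule ideal_sum[OF pj'])
      fix \<beta> assume b: "\<beta> \<in> B - B0"
      then have "\<beta> j - t = Suc (\<beta> j - t - 1)" using t[of \<beta>] by (auto simp: B0_def)
      then have "const (l \<beta>) * (a j ^ (\<beta> j - t) * tail \<beta>) = (const (l \<beta>) * a j ^ (\<beta> j - t - 1) * tail \<beta>) * a j"
        by (metis (no_types, opaque_lifting) mult.assoc mult.commute power_Suc)
      moreover have "const (l \<beta>) * a j ^ (\<beta> j - t - 1) * tail \<beta> \<in> polys V"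
        by (intro polys_intros tail poly step.hyps)
      ultimately show "const (l \<beta>) * (a j ^ (\<beta> j - t) * tail \<beta>) \<in> p (Suc j)"
        using pj' a[OF step.hyps(2)] by (simp add: ideal_mpoly_ring_iff)
    qed
    have Q3: "Q = (\<Sum>\<beta>\<in>B0. const (l \<beta>) * tail \<beta>) + (\<Sum>\<beta>\<in>B - B0. const (l \<beta>) * (a j ^ (\<beta> j - t) * tail \<beta>))"
    proof -
      have "(\<Sum>\<beta>\<in>B0. const (l \<beta>) * tail \<beta>) = (\<Sum>\<beta>\<in>B0. const (l \<beta>) * (a j ^ (\<beta> j - t) * tail \<beta>))"
        by (rule sum.cong) (auto simp: B0_def)
      then show ?thesis unfolding Q_def using sum.subset_diff[OF B0(2) step.prems(1)] by (simp add: add.commute)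
    qed
    have mem: "(\<Sum>\<beta>\<in>B0. const (l \<beta>) * tail \<beta>) \<in> p (Suc j)"
      using ideal_minus[OF pj' Q1 Q2] unfolding Q3 add_diff_cancel_right' .
    have "(\<Sum>\<beta>\<in>B0. const (l \<beta>) * (\<Prod>i\<in>{Suc j..<L}. a i ^ \<beta> i)) \<notin> p (Suc j)"
    proof (rule step.IH)
      show "finite B0" using step.prems(1) B0 finite_subset by blast
      show "\<beta> i = \<gamma> i" if "\<beta> \<in> B0" "\<gamma> \<in> B0" "i < Suc j" for \<beta> \<gamma> i
        using that step.prems(5)[of \<beta> \<gamma> i] by (cases "i = j") (auto simp: B0_def)
    qed (use B0 step.prems in auto)
    then show False using mem by (simp add: tail_def)
  qed
qed

text \<open>The inequality \<open>dim K[V] \<le> |V|\<close>.\<close>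
theorem prime_chain_length_le_card:
  fixes p :: "nat \<Rightarrow> ('v, 'k::field) mpolynomial set"
  assumes V: "finite V"
    and prime: "\<And>j. j \<le> L \<Longrightarrow> primeideal (p j) (mpoly_ring V)"
    and chain: "\<And>j. j < L \<Longrightarrow> p j \<subset> p (Suc j)"
  shows "L \<le> card V"
proof (rule ccontr)
  assume "\<not> L \<le> card V"
  then have L: "card V < L" by simp
  have "\<forall>j. \<exists>a. j < L \<longrightarrow> a \<in> p (Suc j) - p j" using chain by blast
  then obtain a where a: "\<And>j. j < L \<Longrightarrow> a j \<in> p (Suc j) - p j" by metis
  have poly: "a i \<in> polys V" if "i < L" for i
    using a[OF that] prime[of "Suc i"] that by (auto simp: primeideal_mpoly_ring_iff ideal_mpoly_ring_iff)
  obtain B and l :: "(nat \<Rightarrow> nat) \<Rightarrow> 'k" where B: "finite B" "B \<noteq> {}" "B \<subseteq> extensional {..<L}"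
    "\<forall>\<beta>\<in>B. l \<beta> \<noteq> 0" and zero: "(\<Sum>\<beta>\<in>B. const (l \<beta>) * (\<Prod>i<L. a i ^ \<beta> i)) = 0"
    by (rule algebraic_dependence[OF V L poly])
  have "(\<Sum>\<beta>\<in>B. const (l \<beta>) * (\<Prod>i\<in>{0..<L}. a i ^ \<beta> i)) \<notin> p 0"
    by (rule no_relation_along_chain[of L p V a]) (use prime chain a B in auto)
  moreover have "0 \<in> p 0" using prime[of 0] by (simp add: primeideal_mpoly_ring_iff ideal_mpoly_ring_iff)
  ultimately show False using zero by (simp add: atLeast0LessThan)
qed

text \<open>Adding the indeterminates outside \<open>S\<close> one by one prolongs a chain of \<open>l\<close> steps that ends
  in \<open>(S)\<close> to one of \<open>l + |V| - |S|\<close> steps.\<close>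
lemma prime_height_var_ideal_le:
  fixes V S :: "'v set"
  assumes V: "finite V" and S: "S \<subseteq> V"
  shows "prime_height (mpoly_ring V) (var_ideal V S :: ('v, 'k::field) mpolynomial set) \<le> enat (card S)"
  unfolding prime_height_def
proof (rule Sup_least, clarify)
  fix l and p :: "nat \<Rightarrow> ('v, 'k) mpolynomial set"
  assume prime: "\<forall>j\<le>l. primeideal (p j) (mpoly_ring V)" and chain: "\<forall>j<l. p j \<subset> p (Suc j)"
    and pl: "p l = var_ideal V S"
  define d where "d = card (V - S)"
  obtain y where y: "bij_betw y {0..<d} (V - S)"
    using ex_bij_betw_nat_finite[of "V - S"] V by (auto simp: d_def)
  define q where "q j = (if j \<le> l then p j else var_ideal V (S \<union> y ` {0..<j - l}))" for j
  have q: "q j = var_ideal V (S \<union> y ` {0..<j - l})" if "l \<le> j" for j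
    using that pl by (auto simp: q_def)
  have "l + d \<le> card V"
  proof (rule prime_chain_length_le_card[OF V])
    fix j assume j: "j \<le> l + d"
    show "primeideal (q j) (mpoly_ring V)"
      using prime primeideal_var_ideal[OF V] by (auto simp: q_def)
  next
    fix j assume j: "j < l + d"
    show "q j \<subset> q (Suc j)"
    proof (cases "j < l")
      case True
      then show ?thesis using chain by (auto simp: q_def)
    next
      case False
      then have jl: "l \<le> j" "l \<le> Suc j" "j - l < d" using j by auto
      have new: "y (j - l) \<in> V - S" using y jl by (auto simp: bij_betw_def)
      have "y (j - l) \<notin> y ` {0..<j - l}"
      proof
        assume "y (j - l) \<in> y ` {0..<j - l}"
        then obtain i where "i < j - l" "y i = y (j - l)" by auto
        moreover have "i \<in> {0..<d}" "j - l \<in> {0..<d}" using calculation jl by auto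
        ultimately show False using y by (metis bij_betw_inv_into_left less_irrefl)
      qed
      then have "mpoly_var (y (j - l)) \<notin> q j"
        using new by (simp add: q[OF jl(1)] var_in_var_ideal_iff)
      moreover have "mpoly_var (y (j - l)) \<in> q (Suc j)"
        using new jl by (auto simp: q[OF jl(2)] var_in_var_ideal_iff Suc_diff_le)
      moreover have "q j \<subseteq> q (Suc j)"
        unfolding q[OF jl(1)] q[OF jl(2)] by (rule var_ideal_mono) auto
      ultimately show ?thesis by blast
    qed
  qed
  moreover have "card V = card S + d" using V S by (simp add: d_def card_Diff_subset finite_subset card_mono)
  ultimately show "enat l \<le> enat (card S)" by simp
qed

text \<open>The ideals \<open>(z\<^sub>0, \<dots>, z\<^bsub>j-1\<^esub>)\<close> with \<open>j < n\<close>, followed by \<open>P\<close> itself. The last inclusion is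
  strict because \<open>P\<close> contains \<open>z\<^bsub>n-1\<^esub>\<close>.\<close>
lemma number_of_vars_le_prime_height:
  fixes P :: "('v, 'k::field) mpolynomial set"
  assumes V: "finite V" and P: "primeideal P (mpoly_ring V)"
    and z: "inj_on z {..<n}" "\<And>i. i < n \<Longrightarrow> z i \<in> V" "\<And>i. i < n \<Longrightarrow> mpoly_var (z i) \<in> P"
  shows "enat n \<le> prime_height (mpoly_ring V) P"
proof -
  define p where "p j = (if j = n then P else var_ideal V (z ` {..<j}))" for j
  have sub: "var_ideal V (z ` {..<j}) \<subseteq> P" if "j \<le> n" for j
    by (rule var_ideal_subset) (use P z that in \<open>auto simp: primeideal_mpoly_ring_iff\<close>)
  have "p j \<subset> p (Suc j)" if j: "j < n" for j
  proof -
    have "z j \<noteq> z i" if "i < j" for i using inj_onD[OF z(1), of j i] that j by auto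
    then have "z j \<notin> z ` {..<j}" by auto
    then have "mpoly_var (z j) \<notin> p j" using j by (simp add: p_def var_in_var_ideal_iff)
    moreover have "mpoly_var (z j) \<in> p (Suc j)" using j z by (auto simp: p_def var_in_var_ideal_iff)
    moreover have "p j \<subseteq> p (Suc j)"
    proof (cases "Suc j = n")
      case True
      then show ?thesis using j sub[of j] by (simp add: p_def)
    next
      case False
      then show ?thesis using j by (simp add: p_def var_ideal_mono image_mono)
    qed
    ultimately show ?thesis by blast
  qed
  moreover have "primeideal (p j) (mpoly_ring V)" for j
    using P primeideal_var_ideal[OF V] by (auto simp: p_def)
  ultimately show ?thesis unfolding prime_height_def
    by (intro Sup_upper CollectI exI[of _ n] conjI refl exI[of _ p]) (auto simp: p_def)
qed

section \<open>Counting parameters\<close>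

definition lin_span :: "('v, 'k::field) mpolynomial set \<Rightarrow> ('v, 'k) mpolynomial set" where
  "lin_span U = {\<Sum>u\<in>U. const (c u) * u | c. True}"

lemma lin_span_0: "0 \<in> lin_span U"
  unfolding lin_span_def by (intro CollectI exI[of _ "\<lambda>_. 0"]) simp

lemma lin_span_add: "p \<in> lin_span U \<Longrightarrow> q \<in> lin_span U \<Longrightarrow> p + q \<in> lin_span U"
proof -
  assume "p \<in> lin_span U" "q \<in> lin_span U"
  then obtain c d where "p = (\<Sum>u\<in>U. const (c u) * u)" "q = (\<Sum>u\<in>U. const (d u) * u)"
    by (auto simp: lin_span_def)
  then have "p + q = (\<Sum>u\<in>U. const (c u + d u) * u)"
    by (simp add: sum.distrib distrib_right flip: const_add)
  then show ?thesis by (auto simp: lin_span_def)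
qed

lemma lin_span_scale:
  assumes "finite U" "u \<in> U"
  shows "const a * u \<in> lin_span U"
proof -
  have "(\<Sum>w\<in>U. const (if w = u then a else 0) * w) = (\<Sum>w\<in>U. if w = u then const a * u else 0)"
    by (rule sum.cong) auto
  then have "const a * u = (\<Sum>w\<in>U. const (if w = u then a else 0) * w)" using assms by simp
  then show ?thesis unfolding lin_span_def
    by (intro CollectI exI[of _ "\<lambda>w. if w = u then a else 0"] conjI TrueI)
qed

lemma lin_span_sum: "(\<And>i. i \<in> A \<Longrightarrow> f i \<in> lin_span U) \<Longrightarrow> sum f A \<in> lin_span U"
  by (induction A rule: infinite_finite_induct) (auto intro: lin_span_add lin_span_0)

text \<open>For finite \<open>X\<close>, the \<open>m\<close>-th power of the maximal ideal \<open>(X)\<close> of \<open>K[X]\<close>.\<close>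
definition order_ge :: "'v set \<Rightarrow> nat \<Rightarrow> ('v, 'k::field) mpolynomial set" where
  "order_ge X m = {p \<in> polys X. \<forall>e\<in>Poly_Mapping.keys p. m \<le> (\<Sum>v\<in>X. Poly_Mapping.lookup e v)}"

lemma order_ge_0: "0 \<in> order_ge X m"
  by (simp add: order_ge_def)

lemma order_ge_add: "p \<in> order_ge X m \<Longrightarrow> q \<in> order_ge X m \<Longrightarrow> p + q \<in> order_ge X m"
  using Poly_Mapping.keys_add[of p q] by (auto simp: order_ge_def intro: polys_add)

lemma order_ge_mult:
  assumes p: "p \<in> order_ge X m" and q: "q \<in> order_ge X l"
  shows "p * q \<in> order_ge X (m + l)"
proof -
  have "m + l \<le> (\<Sum>v\<in>X. Poly_Mapping.lookup e v)" if e: "e \<in> Poly_Mapping.keys (p * q)" for e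
  proof -
    obtain a b where ab: "e = a + b" "a \<in> Poly_Mapping.keys p" "b \<in> Poly_Mapping.keys q"
      using Poly_Mapping.keys_mult[of p q] e by blast
    have "m \<le> (\<Sum>v\<in>X. Poly_Mapping.lookup a v)" "l \<le> (\<Sum>v\<in>X. Poly_Mapping.lookup b v)"
      using ab p q by (auto simp: order_ge_def)
    then show ?thesis by (simp add: ab(1) lookup_add sum.distrib)
  qed
  then show ?thesis using p q by (auto simp: order_ge_def intro: polys_mult)
qed

lemma var_ideal_self_order_ge:
  assumes "finite X" "p \<in> var_ideal X X"
  shows "p \<in> order_ge X 1"
proof -
  have "1 \<le> (\<Sum>v\<in>X. Poly_Mapping.lookup e v)" if e: "e \<in> Poly_Mapping.keys p" for e
  proof -
    obtain v where v: "v \<in> Poly_Mapping.keys e" "v \<in> X" using e assms(2) by (auto simp: var_ideal_def)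
    have "Poly_Mapping.lookup e v \<le> (\<Sum>v\<in>X. Poly_Mapping.lookup e v)"
      using v assms(1) by (intro member_le_sum) auto
    then show ?thesis using v by (simp add: in_keys_iff)
  qed
  then show ?thesis using assms by (auto simp: order_ge_def var_ideal_def)
qed

definition generated_by :: "'v set \<Rightarrow> nat \<Rightarrow> (nat \<Rightarrow> ('v, 'k::field) mpolynomial) \<Rightarrow> ('v, 'k) mpolynomial set" where
  "generated_by X s b = {\<Sum>j<s. g j * b j | g. \<forall>j<s. g j \<in> polys X}"

lemma ideal_generated_by:
  fixes b :: "nat \<Rightarrow> ('v, 'k::field) mpolynomial"
  assumes b: "\<And>j. j < s \<Longrightarrow> b j \<in> polys X"
  shows "ideal (generated_by X s b) (mpoly_ring X)"
  unfolding ideal_mpoly_ring_iff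
proof (intro conjI ballI)
  show "generated_by X s b \<subseteq> polys X"
    unfolding generated_by_def by (auto intro!: polys_sum polys_mult b)
  show "0 \<in> generated_by X s b"
    unfolding generated_by_def by (intro CollectI exI[of _ "\<lambda>_. 0"]) simp
next
  fix p q :: "('v, 'k) mpolynomial" assume "p \<in> generated_by X s b" "q \<in> generated_by X s b"
  then obtain g h where gh: "p = (\<Sum>j<s. g j * b j)" "\<forall>j<s. g j \<in> polys X"
    "q = (\<Sum>j<s. h j * b j)" "\<forall>j<s. h j \<in> polys X" unfolding generated_by_def by blast
  have "p + q = (\<Sum>j<s. (g j + h j) * b j)" by (simp add: gh distrib_right sum.distrib)
  then show "p + q \<in> generated_by X s b" unfolding generated_by_def using gh
    by (intro CollectI exI[of _ "\<lambda>j. g j + h j"]) (auto intro: polys_add)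
next
  fix p r :: "('v, 'k) mpolynomial" assume "p \<in> generated_by X s b" "r \<in> polys X"
  then obtain g where g: "p = (\<Sum>j<s. g j * b j)" "\<forall>j<s. g j \<in> polys X" "r \<in> polys X"
    unfolding generated_by_def by blast
  have "r * p = (\<Sum>j<s. (r * g j) * b j)" by (simp add: g sum_distrib_left mult.assoc)
  then show "r * p \<in> generated_by X s b" unfolding generated_by_def using g
    by (intro CollectI exI[of _ "\<lambda>j. r * g j"]) (auto intro: polys_mult)
qed

lemma generator_in_generated_by:
  assumes "j < s" shows "b j \<in> generated_by X s b"
proof -
  have "(\<Sum>i<s. (if i = j then 1 else 0) * b i) = (\<Sum>i<s. if i = j then b j else 0)"
    by (rule sum.cong) auto
  then have "(\<Sum>i<s. (if i = j then 1 else 0) * b i) = b j" using assms by simp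
  then show ?thesis unfolding generated_by_def
    by (intro CollectI exI[of _ "\<lambda>i. if i = j then 1 else 0"]) auto
qed

text \<open>Products \<open>x\<^sup>e b\<^sup>\<beta>\<close> of monomials with exponents at most \<open>k\<close> in the indeterminates and less than
  \<open>m\<close> in the parameters \<open>b\<^sub>j\<close>.\<close>
definition filtration_generators ::
  "'v set \<Rightarrow> nat \<Rightarrow> nat \<Rightarrow> (nat \<Rightarrow> ('v, 'k::field) mpolynomial) \<Rightarrow> nat \<Rightarrow> ('v, 'k) mpolynomial set" where
  "filtration_generators X k s b m =
     (\<lambda>(e, \<beta>). Poly_Mapping.single e 1 * (\<Prod>j<s. b j ^ \<beta> j)) `
       (exponent_box X k \<times> PiE {..<s} (\<lambda>_. {..<m}))"

lemma
  assumes "finite X"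
  shows finite_filtration_generators: "finite (filtration_generators X k s b m)"
    and card_filtration_generators:
      "card (filtration_generators X k s b m) \<le> (k + 1) ^ card X * m ^ s"
proof -
  have fin: "finite (exponent_box X k \<times> PiE {..<s} (\<lambda>_. {..<m}))"
    by (intro finite_cartesian_product finite_exponent_box assms finite_PiE) auto
  then show "finite (filtration_generators X k s b m)" unfolding filtration_generators_def by blast
  have "card (filtration_generators X k s b m) \<le> card (exponent_box X k \<times> PiE {..<s} (\<lambda>_. {..<m}))"
    unfolding filtration_generators_def by (rule card_image_le[OF fin])
  also have "\<dots> = card (exponent_box X k) * m ^ s" by (simp add: card_cartesian_product card_PiE)
  also have "\<dots> \<le> (k + 1) ^ card X * m ^ s" by (intro mult_right_mono card_exponent_box assms) simp
  finally show "card (filtration_generators X k s b m) \<le> (k + 1) ^ card X * m ^ s" .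
qed

lemma filtration_generators_step:
  assumes "u \<in> filtration_generators X k s b m" "i < s"
  shows "u * b i \<in> filtration_generators X k s b (Suc m)"
proof -
  obtain e \<beta> where u: "u = Poly_Mapping.single e 1 * (\<Prod>j<s. b j ^ \<beta> j)"
      and e: "e \<in> exponent_box X k" and \<beta>: "\<beta> \<in> PiE {..<s} (\<lambda>_. {..<m})"
    using assms by (auto simp: filtration_generators_def)
  define \<gamma> where "\<gamma> = \<beta>(i := Suc (\<beta> i))"
  have "\<gamma> \<in> PiE {..<s} (\<lambda>_. {..<Suc m})"
    using \<beta> assms(2) by (auto simp: \<gamma>_def PiE_iff extensional_def less_Suc_eq intro: Suc_lessI)
  moreover have "u * b i = Poly_Mapping.single e 1 * (\<Prod>j<s. b j ^ \<gamma> j)"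
  proof -
    have "(\<Prod>j<s. b j ^ \<gamma> j) = b i ^ \<gamma> i * (\<Prod>j\<in>{..<s} - {i}. b j ^ \<gamma> j)"
      using assms(2) by (simp add: prod.remove)
    also have "(\<Prod>j\<in>{..<s} - {i}. b j ^ \<gamma> j) = (\<Prod>j\<in>{..<s} - {i}. b j ^ \<beta> j)"
      by (rule prod.cong) (auto simp: \<gamma>_def)
    also have "b i ^ \<gamma> i * (\<Prod>j\<in>{..<s} - {i}. b j ^ \<beta> j) = b i * (\<Prod>j<s. b j ^ \<beta> j)"
      using assms(2) by (simp add: \<gamma>_def prod.remove[of "{..<s}" i] mult.assoc)
    finally show ?thesis by (simp add: u mult_ac)
  qed
  ultimately show ?thesis unfolding filtration_generators_def using e
    by (intro image_eqI[of _ _ "(e, \<gamma>)"]) auto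
qed

text \<open>A monomial with an exponent above \<open>k\<close> is a combination of the \<open>b\<^sub>j\<close> with polynomial
  coefficients, by the assumption on powers. Hence every polynomial is a combination of monomials
  with exponents at most \<open>k\<close> plus such a combination of the \<open>b\<^sub>j\<close>. Expanding the coefficients in
  the same way, \<open>m\<close> times, leaves a remainder that is divisible by a product of \<open>m\<close> of the \<open>b\<^sub>j\<close>, and
  so has order at least \<open>m\<close>.\<close>
lemma polynomial_decomposition:
  fixes b :: "nat \<Rightarrow> ('v, 'k::field) mpolynomial"
  assumes X: "finite X"
    and b: "\<And>j. j < s \<Longrightarrow> b j \<in> var_ideal X X"
    and pow: "\<And>v. v \<in> X \<Longrightarrow> mpoly_var v ^ k \<in> generated_by X s b"
    and f: "f \<in> polys X"
  shows "\<exists>p\<in>lin_span (filtration_generators X k s b m). \<exists>r\<in>order_ge X m. f = p + r"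
  using f
proof (induction m arbitrary: f)
  case 0
  then have "f \<in> order_ge X 0" by (simp add: order_ge_def)
  then show ?case using lin_span_0 by force
next
  case (Suc m)
  let ?U = "filtration_generators X k s b"
  define T where "T = {p + r | p r. p \<in> lin_span (?U (Suc m)) \<and> r \<in> order_ge X (Suc m)}"
  have T0: "0 \<in> T" unfolding T_def using lin_span_0 order_ge_0 by force
  have T_add: "p + q \<in> T" if p: "p \<in> T" and q: "q \<in> T" for p q
  proof -
    obtain p1 p2 q1 q2 where "p = p1 + p2" "p1 \<in> lin_span (?U (Suc m))" "p2 \<in> order_ge X (Suc m)"
      "q = q1 + q2" "q1 \<in> lin_span (?U (Suc m))" "q2 \<in> order_ge X (Suc m)"
      using p q unfolding T_def by blast
    moreover from this have "p + q = (p1 + q1) + (p2 + q2)" by (simp add: algebra_simps)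
    ultimately show ?thesis unfolding T_def using lin_span_add order_ge_add by blast
  qed
  have T_sum: "sum g A \<in> T" if "\<And>i. i \<in> A \<Longrightarrow> g i \<in> T" for g :: "'i \<Rightarrow> ('v, 'k) mpolynomial" and A
    using that by (induction A rule: infinite_finite_induct) (auto intro: T_add T0)
  have T_mult: "h * b j \<in> T" if h: "h \<in> polys X" and j: "j < s" for h j
  proof -
    obtain p r where pr: "p \<in> lin_span (?U m)" "r \<in> order_ge X m" "h = p + r" using Suc.IH[OF h] by blast
    obtain c where c: "p = (\<Sum>u\<in>?U m. const (c u) * u)" using pr(1) unfolding lin_span_def by blast
    have "p * b j = (\<Sum>u\<in>?U m. const (c u) * (u * b j))" by (simp add: c sum_distrib_right mult.assoc)
    also have "\<dots> \<in> lin_span (?U (Suc m))"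
      by (intro lin_span_sum lin_span_scale finite_filtration_generators X filtration_generators_step j)
    finally have "p * b j \<in> lin_span (?U (Suc m))" .
    moreover have "r * b j \<in> order_ge X (Suc m)"
      using order_ge_mult[OF pr(2) var_ideal_self_order_ge[OF X b[OF j]]] by simp
    ultimately show ?thesis unfolding T_def pr(3) distrib_right by blast
  qed
  have T_mono: "Poly_Mapping.single e c \<in> T" if e: "Poly_Mapping.keys e \<subseteq> X" for e c
  proof (cases "e \<in> exponent_box X k")
    case True
    let ?\<beta> = "restrict (\<lambda>_. 0::nat) {..<s}"
    have "Poly_Mapping.single e 1 * (\<Prod>j<s. b j ^ ?\<beta> j) \<in> ?U (Suc m)"
      unfolding filtration_generators_def using True by (intro image_eqI[of _ _ "(e, ?\<beta>)"]) auto
    then have "Poly_Mapping.single e 1 \<in> ?U (Suc m)" by simp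
    from lin_span_scale[OF finite_filtration_generators[OF X] this, of c]
    have "Poly_Mapping.single e c \<in> lin_span (?U (Suc m))" by (simp add: const_times_single)
    then show ?thesis unfolding T_def using order_ge_0 by force
  next
    case False
    then obtain v where v: "k < Poly_Mapping.lookup e v" using e by (auto simp: exponent_box_def not_le)
    then have vX: "v \<in> X" using e by (metis in_keys_iff less_nat_zero_code subsetD)
    define e' where "e' = e - Poly_Mapping.single v k"
    have e': "e = e' + Poly_Mapping.single v k"
      by (rule poly_mapping_eqI) (use v in \<open>auto simp: e'_def lookup_add lookup_minus lookup_single when_def\<close>)
    have "Poly_Mapping.keys e' \<subseteq> X" using e by (auto simp: e' in_keys_iff lookup_add)
    then have single: "Poly_Mapping.single e' c \<in> polys X" by (rule polys_single)
    obtain g where g: "mpoly_var v ^ k = (\<Sum>j<s. g j * b j)" "\<forall>j<s. g j \<in> polys X"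
      using pow[OF vX] unfolding generated_by_def by blast
    have "Poly_Mapping.single e c = Poly_Mapping.single e' c * mpoly_var v ^ k"
      by (simp add: e' var_power mult_single)
    also have "\<dots> = (\<Sum>j<s. (Poly_Mapping.single e' c * g j) * b j)"
      by (simp add: g sum_distrib_left mult.assoc)
    also have "\<dots> \<in> T" by (rule T_sum, rule T_mult, rule polys_mult[OF single]) (use g in auto)
    finally show ?thesis .
  qed
  have "(\<Sum>e\<in>Poly_Mapping.keys f. Poly_Mapping.single e (Poly_Mapping.lookup f e)) \<in> T"
    by (rule T_sum, rule T_mono) (rule polysD[OF Suc.prems])
  then have "f \<in> T" unfolding poly_eq_sum_monomials[symmetric] .
  then show ?case unfolding T_def by blast
qed

text \<open>This is the inequality \<open>dim \<le> s\<close> for a system of \<open>s\<close> parameters, at the origin of affine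
  space. The \<open>M\<^sup>n\<close> monomials with exponents below \<open>M\<close> have degree less than \<open>m = n M\<close>, so no nontrivial
  combination of them has order at least \<open>m\<close>. By \<open>polynomial_decomposition\<close> they are combinations,
  up to order \<open>m\<close>, of at most \<open>(k+1)\<^sup>n (n M)\<^sup>s\<close> polynomials. If \<open>s < n\<close>, this number is smaller than
  \<open>M\<^sup>n\<close> for large \<open>M\<close>.\<close>
theorem card_le_number_of_parameters:
  fixes b :: "nat \<Rightarrow> ('v, 'k::field) mpolynomial"
  assumes X: "finite X"
    and b: "\<And>j. j < s \<Longrightarrow> b j \<in> var_ideal X X"
    and pow: "\<And>v. v \<in> X \<Longrightarrow> mpoly_var v ^ k \<in> generated_by X s b"
  shows "card X \<le> s"
proof (rule ccontr)
  define n where "n = card X"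
  assume "\<not> card X \<le> s"
  then have sn: "s < n" by (simp add: n_def)
  \<comment> \<open>Chosen so that \<open>(k + 1)\<^sup>n (n M)\<^sup>s < M\<^bsup>s + 1\<^esup>\<close>.\<close>
  define M where "M = (k + 1) ^ n * n ^ s + 1"
  define m where "m = n * M"
  define U where "U = filtration_generators X k s b m"
  define A where "A = PiE X (\<lambda>_. {..<M})"
  define ex where "ex \<alpha> = (\<Sum>v\<in>X. Poly_Mapping.single v (\<alpha> v))" for \<alpha> :: "'v \<Rightarrow> nat"
  have lookup_ex: "Poly_Mapping.lookup (ex \<alpha>) v = (if v \<in> X then \<alpha> v else 0)" for \<alpha> v
    using X by (simp add: ex_def lookup_sum lookup_single when_def)
  have keys_ex: "Poly_Mapping.keys (ex \<alpha>) \<subseteq> X" for \<alpha>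
    by (auto simp: in_keys_iff lookup_ex split: if_splits)
  have inj_ex: "\<alpha> = \<alpha>'" if "\<alpha> \<in> A" "\<alpha>' \<in> A" "ex \<alpha> = ex \<alpha>'" for \<alpha> \<alpha>'
  proof (rule PiE_ext)
    show "\<alpha> \<in> PiE X (\<lambda>_. {..<M})" "\<alpha>' \<in> PiE X (\<lambda>_. {..<M})" using that by (auto simp: A_def)
    fix v assume "v \<in> X"
    then show "\<alpha> v = \<alpha>' v" using lookup_ex[of \<alpha> v] lookup_ex[of \<alpha>' v] that(3) by simp
  qed
  have deg_ex: "(\<Sum>v\<in>X. Poly_Mapping.lookup (ex \<alpha>) v) < m" if "\<alpha> \<in> A" for \<alpha>
  proof -
    have "(\<Sum>v\<in>X. Poly_Mapping.lookup (ex \<alpha>) v) < (\<Sum>v\<in>X. M)"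
    proof (rule sum_strict_mono)
      show "X \<noteq> {}" using sn by (auto simp: n_def)
      fix v assume "v \<in> X"
      then show "Poly_Mapping.lookup (ex \<alpha>) v < M"
        using PiE_mem[OF that[unfolded A_def]] by (simp add: lookup_ex)
    qed (rule X)
    then show ?thesis by (simp add: m_def n_def)
  qed
  have finA: "finite A" and cardA: "card A = M ^ n"
    using X by (simp_all add: A_def finite_PiE card_PiE n_def)
  have finU: "finite U" unfolding U_def by (rule finite_filtration_generators[OF X])
  have "card U \<le> (k + 1) ^ n * m ^ s" unfolding U_def n_def by (rule card_filtration_generators[OF X])
  also have "\<dots> = ((k + 1) ^ n * n ^ s) * M ^ s" by (simp add: m_def power_mult_distrib)
  also have "\<dots> < M * M ^ s" by (simp add: M_def)
  also have "\<dots> = M ^ Suc s" by simp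
  also have "\<dots> \<le> M ^ n" using sn by (intro power_increasing) (auto simp: M_def)
  finally have card: "card U < card A" by (simp add: cardA)
  have "\<forall>\<alpha>. \<exists>c r. Poly_Mapping.single (ex \<alpha>) 1 = (\<Sum>u\<in>U. const (c u) * u) + r \<and> r \<in> order_ge X m"
  proof
    fix \<alpha>
    have "\<exists>p\<in>lin_span U. \<exists>r\<in>order_ge X m. Poly_Mapping.single (ex \<alpha>) 1 = p + r"
      unfolding U_def by (rule polynomial_decomposition[OF X b pow polys_single[OF keys_ex]])
    then show "\<exists>c r. Poly_Mapping.single (ex \<alpha>) 1 = (\<Sum>u\<in>U. const (c u) * u) + r \<and> r \<in> order_ge X m"
      unfolding lin_span_def by blast
  qed
  then obtain c r where cr: "\<And>\<alpha>. Poly_Mapping.single (ex \<alpha>) 1 = (\<Sum>u\<in>U. const (c \<alpha> u) * u) + r \<alpha>"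
      "\<And>\<alpha>. r \<alpha> \<in> order_ge X m"
    unfolding choice_iff by blast
  \<comment> \<open>A combination of the monomials in which all components along \<open>U\<close> cancel has order at least \<open>m\<close>,
    against their degrees.\<close>
  obtain l where l: "\<exists>\<alpha>\<in>A. l \<alpha> \<noteq> 0" "\<forall>u\<in>U. (\<Sum>\<alpha>\<in>A. l \<alpha> * c \<alpha> u) = 0"
    using underdetermined_system_solution[OF finU finA card, of c] by blast
  then obtain \<alpha>0 where \<alpha>0: "\<alpha>0 \<in> A" "l \<alpha>0 \<noteq> 0" by blast
  have "(\<Sum>\<alpha>\<in>A. const (l \<alpha>) * Poly_Mapping.single (ex \<alpha>) 1) =
      (\<Sum>\<alpha>\<in>A. \<Sum>u\<in>U. const (l \<alpha> * c \<alpha> u) * u) + (\<Sum>\<alpha>\<in>A. const (l \<alpha>) * r \<alpha>)"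
    by (simp add: cr(1) distrib_left sum.distrib sum_distrib_left const_mult[symmetric] mult.assoc)
  also have "(\<Sum>\<alpha>\<in>A. \<Sum>u\<in>U. const (l \<alpha> * c \<alpha> u) * u) = (\<Sum>u\<in>U. const (\<Sum>\<alpha>\<in>A. l \<alpha> * c \<alpha> u) * u)"
    by (subst sum.swap) (simp add: const_sum sum_distrib_right)
  also have "\<dots> = 0" using l(2) by simp
  finally have eq: "(\<Sum>\<alpha>\<in>A. const (l \<alpha>) * Poly_Mapping.single (ex \<alpha>) 1) = (\<Sum>\<alpha>\<in>A. const (l \<alpha>) * r \<alpha>)"
    by simp
  have "Poly_Mapping.lookup (\<Sum>\<alpha>\<in>A. const (l \<alpha>) * Poly_Mapping.single (ex \<alpha>) 1) (ex \<alpha>0)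
      = (\<Sum>\<alpha>\<in>A. if \<alpha> = \<alpha>0 then l \<alpha>0 else 0)"
    unfolding lookup_sum
    by (rule sum.cong) (use inj_ex \<alpha>0(1) in \<open>auto simp: lookup_const_times lookup_single when_def\<close>)
  also have "\<dots> = l \<alpha>0" using \<alpha>0(1) finA by simp
  finally have "Poly_Mapping.lookup (\<Sum>\<alpha>\<in>A. const (l \<alpha>) * r \<alpha>) (ex \<alpha>0) = l \<alpha>0" using eq by simp
  moreover have "Poly_Mapping.lookup (r \<alpha>) (ex \<alpha>0) = 0" for \<alpha>
  proof (rule ccontr)
    assume "Poly_Mapping.lookup (r \<alpha>) (ex \<alpha>0) \<noteq> 0"
    then have "ex \<alpha>0 \<in> Poly_Mapping.keys (r \<alpha>)" by (simp add: in_keys_iff)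
    then show False using cr(2)[of \<alpha>] deg_ex[OF \<alpha>0(1)] by (auto simp: order_ge_def)
  qed
  ultimately show False using \<alpha>0(2) by (simp add: lookup_sum lookup_const_times)
qed

section \<open>Lower bound for the arithmetical rank\<close>

lemma ideal_subst_preimage:
  fixes f :: "'v \<Rightarrow> ('w, 'k::field) mpolynomial"
  assumes J: "ideal J (mpoly_ring W)" and f: "\<And>v. v \<in> V \<Longrightarrow> f v \<in> polys W"
  shows "ideal {p \<in> polys V. subst f p \<in> J} (mpoly_ring V)"
  unfolding ideal_mpoly_ring_iff
proof (intro conjI ballI)
  show "0 \<in> {p \<in> polys V. subst f p \<in> J}" using J by (simp add: ideal_mpoly_ring_iff)
next
  fix p q :: "('v, 'k) mpolynomial" assume "p \<in> {p \<in> polys V. subst f p \<in> J}" "q \<in> {p \<in> polys V. subst f p \<in> J}"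
  then show "p + q \<in> {p \<in> polys V. subst f p \<in> J}"
    using J by (simp add: ideal_mpoly_ring_iff subst_add polys_add)
next
  fix p r :: "('v, 'k) mpolynomial" assume p: "p \<in> {p \<in> polys V. subst f p \<in> J}" and r: "r \<in> polys V"
  then show "r * p \<in> {p \<in> polys V. subst f p \<in> J}"
    using J subst_polys[OF r f] by (simp add: ideal_mpoly_ring_iff subst_mult polys_mult)
qed auto

lemma ideal_radical_iff:
  "a \<in> ideal_radical (mpoly_ring V) J \<longleftrightarrow> a \<in> polys V \<and> (\<exists>k. a ^ k \<in> J)"
  by (simp add: ideal_radical_def mpoly_ring_pow polys_def)

lemma subset_ideal_radical: "J \<subseteq> polys V \<Longrightarrow> J \<subseteq> ideal_radical (mpoly_ring V) J"
  by (auto simp: ideal_radical_iff intro!: exI[of _ 1])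

lemma genideal_mpoly_ring:
  assumes "S \<subseteq> polys V"
  shows ideal_genideal: "ideal (genideal (mpoly_ring V) S) (mpoly_ring V)"
    and subset_genideal: "S \<subseteq> genideal (mpoly_ring V) S"
    and genideal_least: "ideal J (mpoly_ring V) \<Longrightarrow> S \<subseteq> J \<Longrightarrow> genideal (mpoly_ring V) S \<subseteq> J"
proof -
  have R: "ring (mpoly_ring V)" using cring_mpoly_ring by (rule cring.axioms)
  have S: "S \<subseteq> carrier (mpoly_ring V)" unfolding carrier_mpoly_ring by (rule assms)
  show "ideal (genideal (mpoly_ring V) S) (mpoly_ring V)" "S \<subseteq> genideal (mpoly_ring V) S"
    by (rule ring.genideal_ideal[OF R S], rule ring.genideal_self[OF R S])
  show "ideal J (mpoly_ring V) \<Longrightarrow> S \<subseteq> J \<Longrightarrow> genideal (mpoly_ring V) S \<subseteq> J"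
    by (rule ring.genideal_minimal[OF R])
qed

text \<open>Set the indeterminates outside \<open>X\<close> to 1. By \<open>local\<close>, the image of \<open>I\<close> contains every \<open>x \<in> X\<close>,
  so the images of the given elements generate an ideal that contains a power of each. By
  \<open>I \<subseteq> (X)\<close>, they have no constant term, and \<open>card_le_number_of_parameters\<close> applies.\<close>
theorem card_le_length_radical_generators:
  fixes I :: "('v, 'k::field) mpolynomial set"
  assumes V: "finite V" and X: "X \<subseteq> V" and I: "I \<subseteq> var_ideal V X"
    and local: "\<And>x. x \<in> X \<Longrightarrow> \<exists>W. W \<subseteq> V - X \<and> mpoly_var x * (\<Prod>v\<in>W. mpoly_var v) \<in> I"
    and as: "set as \<subseteq> polys V"
    and rad: "ideal_radical (mpoly_ring V) (genideal (mpoly_ring V) (set as)) = ideal_radical (mpoly_ring V) I"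
  shows "card X \<le> length as"
proof -
  define f :: "'v \<Rightarrow> ('v, 'k) mpolynomial" where "f v = (if v \<in> X then mpoly_var v else 1)" for v
  define b where "b j = subst f (as ! j)" for j
  let ?B = "generated_by X (length as) b"
  have finX: "finite X" using V X finite_subset by blast
  have fpol: "f v \<in> polys X" for v by (simp add: f_def polys_var)
  have prime: "primeideal (var_ideal V X :: ('v, 'k) mpolynomial set) (mpoly_ring V)" by (rule primeideal_var_ideal[OF V])
  \<comment> \<open>An inclusion between an ideal and a preimage can be checked on generators.\<close>
  have idl: "var_ideal V X \<subseteq> {p \<in> polys V. subst f p \<in> var_ideal X X}"
  proof (rule var_ideal_subset)
    show "ideal {p \<in> polys V. subst f p \<in> var_ideal X X} (mpoly_ring V)"
      by (rule ideal_subst_preimage[OF ideal_var_ideal fpol])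
    show "mpoly_var v \<in> {p \<in> polys V. subst f p \<in> var_ideal X X}" if "v \<in> X \<inter> V" for v
      using that by (simp add: polys_var f_def var_in_var_ideal_iff)
  qed
  have b: "b j \<in> var_ideal X X" if j: "j < length as" for j
  proof -
    have "as ! j \<in> genideal (mpoly_ring V) (set as)" using subset_genideal[OF as] j by auto
    moreover have "genideal (mpoly_ring V) (set as) \<subseteq> polys V"
      using ideal_genideal[OF as] by (simp add: ideal_mpoly_ring_iff)
    ultimately have "as ! j \<in> ideal_radical (mpoly_ring V) I" using subset_ideal_radical rad by blast
    then obtain k where "as ! j \<in> polys V" "as ! j ^ k \<in> var_ideal V X" using I unfolding ideal_radical_iff by blast
    then have "as ! j \<in> var_ideal V X" using primeideal_power[OF prime] by blast
    then show ?thesis using idl by (auto simp: b_def)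
  qed
  have B: "ideal ?B (mpoly_ring X)" by (rule ideal_generated_by) (use b in \<open>auto simp: var_ideal_def\<close>)
  have gen: "genideal (mpoly_ring V) (set as) \<subseteq> {p \<in> polys V. subst f p \<in> ?B}"
  proof (rule genideal_least[OF as ideal_subst_preimage[OF B fpol]], rule subsetI)
    fix a assume a: "a \<in> set as"
    then obtain j where "j < length as" "a = as ! j" by (auto simp: in_set_conv_nth)
    then have "subst f a \<in> ?B" using generator_in_generated_by[of j "length as" b X] by (simp add: b_def)
    then show "a \<in> {p \<in> polys V. subst f p \<in> ?B}" using a as by auto
  qed
  have "\<exists>k. mpoly_var x ^ k \<in> ?B" if x: "x \<in> X" for x
  proof -
    obtain W where W: "W \<subseteq> V - X" "mpoly_var x * (\<Prod>v\<in>W. mpoly_var v) \<in> I" using local[OF x] by blast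
    let ?p = "mpoly_var x * (\<Prod>v\<in>W. mpoly_var v) :: ('v, 'k) mpolynomial"
    have "I \<subseteq> polys V" using I by (auto simp: var_ideal_def)
    then have "?p \<in> ideal_radical (mpoly_ring V) I" using subset_ideal_radical W(2) by blast
    then obtain k where "?p ^ k \<in> genideal (mpoly_ring V) (set as)"
      unfolding rad[symmetric] ideal_radical_iff by blast
    then have "subst f (?p ^ k) \<in> ?B" using gen by blast
    moreover have "subst f ?p = mpoly_var x"
    proof -
      have "(\<Prod>v\<in>W. f v) = 1" using W(1) by (intro prod.neutral) (auto simp: f_def)
      then show ?thesis using x by (simp add: subst_mult subst_prod) (simp add: f_def)
    qed
    ultimately show ?thesis unfolding subst_power by auto
  qed
  then obtain k where k: "\<And>x. x \<in> X \<Longrightarrow> mpoly_var x ^ k x \<in> ?B" by metis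
  \<comment> \<open>The sum of the exponents serves as a common exponent for all \<open>x\<close>.\<close>
  have "mpoly_var x ^ (\<Sum>y\<in>X. k y) \<in> ?B" if x: "x \<in> X" for x
  proof -
    have "k x \<le> (\<Sum>y\<in>X. k y)" using x finX by (intro member_le_sum) auto
    then obtain d where "(\<Sum>y\<in>X. k y) = d + k x" using le_Suc_ex by (metis add.commute)
    then have "mpoly_var x ^ (\<Sum>y\<in>X. k y) = mpoly_var x ^ d * (mpoly_var x ^ k x :: ('v, 'k) mpolynomial)"
      by (simp add: power_add)
    moreover have "mpoly_var x ^ d * mpoly_var x ^ k x \<in> ?B"
      using B k[OF x] polys_power[OF polys_var[OF x], of d] unfolding ideal_mpoly_ring_iff by blast
    ultimately show ?thesis by simp
  qed
  from card_le_number_of_parameters[OF finX b this] show ?thesis .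
qed

section \<open>The Schmitt--Vogel lemma\<close>

lemma polys_of_nat: "of_nat n \<in> polys V"
  by (induction n) (auto intro: polys_add)

text \<open>If \<open>a\<^sup>i\<close> and \<open>b\<^sup>j\<close> lie in \<open>J\<close>, then so does each term of the binomial expansion of
  \<open>(a + b)\<^bsup>i+j\<^esup>\<close>.\<close>
lemma ideal_ideal_radical:
  fixes J :: "('v, 'k::field) mpolynomial set"
  assumes J: "ideal J (mpoly_ring V)"
  shows "ideal (ideal_radical (mpoly_ring V) J) (mpoly_ring V)"
  unfolding ideal_mpoly_ring_iff
proof (intro conjI ballI)
  have mult: "r * a \<in> J" if "a \<in> J" "r \<in> polys V" for a r
    using J that by (simp add: ideal_mpoly_ring_iff)
  show "ideal_radical (mpoly_ring V) J \<subseteq> polys V" by (auto simp: ideal_radical_iff)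
  show "0 \<in> ideal_radical (mpoly_ring V) J"
    using J by (auto simp: ideal_radical_iff ideal_mpoly_ring_iff intro!: exI[of _ 1])
  show "a + b \<in> ideal_radical (mpoly_ring V) J"
    if "a \<in> ideal_radical (mpoly_ring V) J" "b \<in> ideal_radical (mpoly_ring V) J" for a b
  proof -
    from that obtain i j where ab: "a \<in> polys V" "b \<in> polys V" "a ^ i \<in> J" "b ^ j \<in> J"
      unfolding ideal_radical_iff by blast
    have "(\<Sum>l\<le>i + j. of_nat (i + j choose l) * a ^ l * b ^ (i + j - l)) \<in> J"
    proof (rule ideal_sum[OF J])
      fix l
      show "of_nat (i + j choose l) * a ^ l * b ^ (i + j - l) \<in> J"
      proof (cases "i \<le> l")
        case True
        then have "a ^ l = a ^ (l - i) * a ^ i" by (simp flip: power_add)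
        then have "of_nat (i + j choose l) * a ^ l * b ^ (i + j - l)
            = (of_nat (i + j choose l) * a ^ (l - i) * b ^ (i + j - l)) * a ^ i" by (simp add: mult_ac)
        also have "\<dots> \<in> J" by (intro mult ab polys_mult polys_power polys_of_nat)
        finally show ?thesis .
      next
        case False
        then have "b ^ (i + j - l) = b ^ (i - l) * b ^ j" by (simp flip: power_add)
        then have "of_nat (i + j choose l) * a ^ l * b ^ (i + j - l)
            = (of_nat (i + j choose l) * a ^ l * b ^ (i - l)) * b ^ j" by (simp add: mult_ac)
        also have "\<dots> \<in> J" by (intro mult ab polys_mult polys_power polys_of_nat)
        finally show ?thesis .
      qed
    qed
    then have "(a + b) ^ (i + j) \<in> J" by (simp add: binomial_ring)
    then show ?thesis using ab by (auto simp: ideal_radical_iff intro: polys_add)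
  qed
  show "r * a \<in> ideal_radical (mpoly_ring V) J"
    if "a \<in> ideal_radical (mpoly_ring V) J" "r \<in> polys V" for a r
  proof -
    from that obtain i where a: "a \<in> polys V" "a ^ i \<in> J" unfolding ideal_radical_iff by blast
    have "(r * a) ^ i \<in> J" unfolding power_mult_distrib by (intro mult a polys_power that)
    then show ?thesis using a that by (auto simp: ideal_radical_iff intro: polys_mult)
  qed
qed

lemma ideal_radical_power:
  assumes "a \<in> polys V" "a ^ k \<in> ideal_radical (mpoly_ring V) J"
  shows "a \<in> ideal_radical (mpoly_ring V) J"
  using assms by (auto simp: ideal_radical_iff power_mult[symmetric])

lemma ideal_radical_least:
  assumes "J \<subseteq> ideal_radical (mpoly_ring V) J'"
  shows "ideal_radical (mpoly_ring V) J \<subseteq> ideal_radical (mpoly_ring V) J'"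
proof
  fix a assume "a \<in> ideal_radical (mpoly_ring V) J"
  then obtain k where "a \<in> polys V" "a ^ k \<in> J" unfolding ideal_radical_iff by blast
  then show "a \<in> ideal_radical (mpoly_ring V) J'" using assms ideal_radical_power by blast
qed

lemma ideal_radical_genideal_eqI:
  assumes "S \<subseteq> polys V" "T \<subseteq> polys V"
    and "S \<subseteq> ideal_radical (mpoly_ring V) (genideal (mpoly_ring V) T)"
    and "T \<subseteq> ideal_radical (mpoly_ring V) (genideal (mpoly_ring V) S)"
  shows "ideal_radical (mpoly_ring V) (genideal (mpoly_ring V) S) =
         ideal_radical (mpoly_ring V) (genideal (mpoly_ring V) T)"
  by (intro antisym ideal_radical_least genideal_least ideal_ideal_radical ideal_genideal assms)

text \<open>Modulo the radical, treat the large sets first. If \<open>m T\<close> is in the radical for all larger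
  \<open>T\<close>, then so are the products \<open>m S * m T\<close> of distinct members of the layer of \<open>S\<close>, because \<open>S \<union> T\<close>
  is larger than \<open>S\<close>. Multiplying the sum of that layer by \<open>m S\<close> leaves \<open>(m S)\<^sup>2\<close>.\<close>
theorem Schmitt_Vogel_subset_lattice:
  fixes m :: "'x set \<Rightarrow> ('v, 'k::field) mpolynomial"
  assumes X: "finite X" and J: "ideal J (mpoly_ring V)"
    and m: "\<And>S. S \<subseteq> X \<Longrightarrow> S \<noteq> {} \<Longrightarrow> m S \<in> polys V"
    and mult: "\<And>S T. S \<subseteq> X \<Longrightarrow> T \<subseteq> X \<Longrightarrow> S \<noteq> {} \<Longrightarrow> T \<noteq> {} \<Longrightarrow> \<exists>r\<in>polys V. m S * m T = r * m (S \<union> T)"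
    and layers: "\<And>k. k \<in> {1..card X} \<Longrightarrow> (\<Sum>S | S \<subseteq> X \<and> card S = k. m S) \<in> J"
    and S: "S \<subseteq> X" "S \<noteq> {}"
  shows "m S \<in> ideal_radical (mpoly_ring V) J"
  using S
proof (induction "card X - card S" arbitrary: S rule: less_induct)
  case less
  let ?N = "ideal_radical (mpoly_ring V) J"
  define L where "L = {T. T \<subseteq> X \<and> card T = card S}"
  have finS: "finite S" using less.prems X finite_subset by blast
  have N: "ideal ?N (mpoly_ring V)" by (rule ideal_ideal_radical[OF J])
  have finL: "finite L" unfolding L_def using X by simp
  have SL: "S \<in> L" using less.prems by (simp add: L_def)
  have "card S \<in> {1..card X}" using less.prems X finS by (simp add: card_mono Suc_le_eq card_gt_0_iff)
  from layers[OF this] have "sum m L \<in> ?N"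
    using subset_ideal_radical[of J V] J by (auto simp: L_def ideal_mpoly_ring_iff)
  then have all: "m S * sum m L \<in> ?N" using N m[OF less.prems] by (simp add: ideal_mpoly_ring_iff)
  have "(\<Sum>T\<in>L - {S}. m S * m T) \<in> ?N"
  proof (rule ideal_sum[OF N])
    fix T assume "T \<in> L - {S}"
    then have T: "T \<subseteq> X" "card T = card S" "T \<noteq> S" by (auto simp: L_def)
    have finT: "finite T" using T X finite_subset by blast
    have "T \<noteq> {}" using T(2) less.prems finS by auto
    then obtain r where r: "r \<in> polys V" "m S * m T = r * m (S \<union> T)" using mult less.prems T(1) by blast
    have "S \<subset> S \<union> T" using T(2,3) card_subset_eq[OF finS, of T] by auto
    then have "card S < card (S \<union> T)" using finS finT by (intro psubset_card_mono) auto
    moreover have "card (S \<union> T) \<le> card X" using less.prems T X by (intro card_mono) auto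
    ultimately have "m (S \<union> T) \<in> ?N" using less.prems T(1) by (intro less.hyps) auto
    then show "m S * m T \<in> ?N" using N r by (simp add: ideal_mpoly_ring_iff)
  qed
  from ideal_minus[OF N all this] have "m S ^ 2 \<in> ?N"
    unfolding sum_distrib_left by (simp add: sum.remove[OF finL SL] power2_eq_square)
  then show ?case by (rule ideal_radical_power[OF m[OF less.prems]])
qed

section \<open>Squarefree monomials\<close>

definition sqfree_monomial :: "'v set \<Rightarrow> ('v, 'k::field) mpolynomial" where
  "sqfree_monomial A = (\<Prod>v\<in>A. mpoly_var v)"

lemma sqfree_monomial_polys: "A \<subseteq> V \<Longrightarrow> sqfree_monomial A \<in> polys V"
  unfolding sqfree_monomial_def by (intro polys_prod polys_var) auto

lemma sqfree_monomial_subset: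
  assumes "finite A" "B \<subseteq> A"
  shows "sqfree_monomial A = sqfree_monomial (A - B) * sqfree_monomial B"
  unfolding sqfree_monomial_def by (rule prod.subset_diff[OF assms(2,1)])

lemma sqfree_monomial_in_ideal:
  fixes J :: "('v, 'k::field) mpolynomial set"
  assumes J: "ideal J (mpoly_ring V)" and "sqfree_monomial B \<in> J" "B \<subseteq> A" "A \<subseteq> V" "finite V"
  shows "sqfree_monomial A \<in> J"
proof -
  have "finite A" using assms finite_subset by blast
  moreover have "(sqfree_monomial (A - B) :: ('v, 'k) mpolynomial) \<in> polys V"
    by (rule sqfree_monomial_polys) (use assms in blast)
  ultimately show ?thesis using J assms(2,3) by (simp add: sqfree_monomial_subset[of A B] ideal_mpoly_ring_iff)
qed

lemma sqfree_monomial_mult: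
  assumes V: "finite V" "A \<subseteq> V" "B \<subseteq> V" and C: "C \<subseteq> A \<union> B"
  shows "\<exists>r\<in>polys V. (sqfree_monomial A :: ('v, 'k::field) mpolynomial) * sqfree_monomial B = r * sqfree_monomial C"
proof (rule bexI)
  have "finite A" "finite B" using V finite_subset by blast+
  then have "(sqfree_monomial A :: ('v, 'k) mpolynomial) * sqfree_monomial B = sqfree_monomial (A \<union> B) * sqfree_monomial (A \<inter> B)"
    unfolding sqfree_monomial_def by (rule prod.union_inter[symmetric])
  then show "(sqfree_monomial A :: ('v, 'k) mpolynomial) * sqfree_monomial B =
      (sqfree_monomial (A \<inter> B) * sqfree_monomial (A \<union> B - C)) * sqfree_monomial C"
    using \<open>finite A\<close> \<open>finite B\<close> by (simp add: sqfree_monomial_subset[OF _ C] mult_ac)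
  show "(sqfree_monomial (A \<inter> B) * sqfree_monomial (A \<union> B - C) :: ('v, 'k) mpolynomial) \<in> polys V"
    by (intro polys_mult sqfree_monomial_polys) (use V in auto)
qed

lemma primeideal_sqfree_monomial:
  fixes P :: "('v, 'k::field) mpolynomial set"
  assumes P: "primeideal P (mpoly_ring V)" and A: "A \<subseteq> V" "finite A" and "sqfree_monomial A \<in> P"
  shows "\<exists>v\<in>A. mpoly_var v \<in> P"
  using A(2,1) assms(4)
proof (induction A rule: finite_induct)
  case empty
  then show ?case using P by (simp add: sqfree_monomial_def primeideal_mpoly_ring_iff)
next
  case (insert v A)
  have "mpoly_var v * sqfree_monomial A \<in> P" using insert by (simp add: sqfree_monomial_def)
  moreover have "mpoly_var v \<in> polys V" "(sqfree_monomial A :: ('v, 'k) mpolynomial) \<in> polys V"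
    using insert.prems by (auto intro: polys_var sqfree_monomial_polys)
  ultimately have "mpoly_var v \<in> P \<or> sqfree_monomial A \<in> P"
    using P unfolding primeideal_mpoly_ring_iff by blast
  then show ?case using insert by auto
qed

lemma facet_ideal_eq:
  "facet_ideal \<Gamma> = genideal (mpoly_ring (complex_vertices \<Gamma>)) (sqfree_monomial ` complex_facets \<Gamma>)"
  unfolding facet_ideal_def sqfree_monomial_def by (simp add: image_def Bex_def conj_commute Setcompr_eq_image)

section \<open>Complexes with a facet attached at every vertex\<close>

theorem proposition4p1:
  fixes n :: nat and x :: "nat \<Rightarrow> 'v" and F :: "nat \<Rightarrow> 'v set"
    and \<Delta> \<Delta>' :: "'v set set"
    and R :: "('v, 'k::field) mpolynomial ring" and I :: "('v, 'k) mpolynomial set"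
  assumes "1 \<le> n"
    and "abstract_simplicial_complex \<Delta>"
    and "inj_on x {1..n}"
    and "complex_vertices \<Delta> = x ` {1..n}"
    and "\<And>i. i \<in> {1..n} \<Longrightarrow> finite (F i)"
    and "\<And>i. i \<in> {1..n} \<Longrightarrow> face_dim (F i) \<ge> 1"
    and "\<And>i. i \<in> {1..n} \<Longrightarrow> F i \<inter> complex_vertices \<Delta> = {x i}"
    and "\<And>i j. i \<in> {1..n} \<Longrightarrow> j \<in> {1..n} \<Longrightarrow> i \<noteq> j \<Longrightarrow> F i \<inter> F j = {}"
    and "\<Delta>' = \<Delta> \<union> (\<Union>i\<in>{1..n}. Pow (F i))"
    and "R = mpoly_ring (complex_vertices \<Delta>')"
    and "I = facet_ideal \<Delta>'"
  shows "ideal_height R I = enat n \<and> arithmetical_rank R I = enat n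
    \<and> set_theoretic_complete_intersection R I"
proof -
  note finF = assms(5) and disjoint = assms(8)
  define X where "X = x ` {1..n}"
  define V where "V = (\<Union>i\<in>{1..n}. F i)"
  define G where "G = complex_facets \<Delta>'"
  have cardX: "card X = n" using assms(3) by (simp add: X_def card_image)
  have finX: "finite X" by (simp add: X_def)
  have finV: "finite V" using finF by (simp add: V_def)
  have FX: "F i \<inter> X = {x i}" if "i \<in> {1..n}" for i using assms(7)[OF that] assms(4) by (simp add: X_def)
  have xF: "x i \<in> F i" if "i \<in> {1..n}" for i using FX[OF that] by blast
  have F_not_singleton: "F i \<noteq> {x i}" if "i \<in> {1..n}" for i using assms(6)[OF that] by (auto simp: face_dim_def)
  have XV: "X \<subseteq> V" using xF by (auto simp: X_def V_def)
  have FV: "F i \<subseteq> V" if "i \<in> {1..n}" for i using that by (auto simp: V_def)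
  have face_X: "A \<subseteq> X" if "A \<in> \<Delta>" for A
  proof
    fix v assume "v \<in> A"
    then have "{v} \<in> \<Delta>" using assms(2) that by (simp add: abstract_simplicial_complex_def)
    then have "v \<in> complex_vertices \<Delta>" by (simp add: complex_vertices_def)
    then show "v \<in> X" using assms(4) by (simp add: X_def)
  qed
  have vertices: "complex_vertices \<Delta>' = V"
  proof (rule Set.set_eqI)
    fix v
    have "{v} \<in> \<Delta> \<Longrightarrow> v \<in> V" using face_X[of "{v}"] XV by auto
    then show "v \<in> complex_vertices \<Delta>' \<longleftrightarrow> v \<in> V"
      by (auto simp: complex_vertices_def assms(9) V_def)
  qed
  have whisker_facet: "F i \<in> G" if i: "i \<in> {1..n}" for i
  proof -
    have "B = F i" if B: "B \<in> \<Delta>'" "F i \<subseteq> B" for B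
    proof (cases "B \<in> \<Delta>")
      case True
      then have "F i \<subseteq> X" using face_X B(2) by blast
      then show ?thesis using FX[OF i] F_not_singleton[OF i] by blast
    next
      case False
      then obtain j where j: "j \<in> {1..n}" "B \<subseteq> F j" using B(1) by (auto simp: assms(9))
      then have "i = j" using disjoint[of i j] i xF[OF i] B(2) by blast
      then show ?thesis using j B(2) by blast
    qed
    then show ?thesis using i by (auto simp: G_def complex_facets_def assms(9))
  qed
  have facet_max: "A = F i" if "A \<in> G" "A \<subseteq> F i" "i \<in> {1..n}" for A i
  proof -
    have "F i \<in> \<Delta>'" using that(3) unfolding assms(9) by blast
    then show ?thesis using that(1,2) unfolding G_def complex_facets_def by blast
  qed
  have facet_cases: "A \<subseteq> X \<or> (\<exists>i\<in>{1..n}. A = F i)" if A: "A \<in> G" for A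
  proof (cases "A \<in> \<Delta>")
    case False
    then obtain i where "i \<in> {1..n}" "A \<subseteq> F i" using A by (auto simp: G_def complex_facets_def assms(9))
    then show ?thesis using facet_max[OF A] by blast
  qed (use face_X in blast)
  have facet_V: "A \<subseteq> V" if "A \<in> G" for A using facet_cases[OF that] XV FV by blast
  have facet_nonempty: "A \<noteq> {}" if "A \<in> G" for A
  proof
    assume "A = {}"
    moreover have "1 \<in> {1..n}" using assms(1) by simp
    ultimately show False using facet_max[OF that, of 1] xF[of 1] by blast
  qed
  have no_facet_singleton: "\<not> A \<subseteq> {x i}" if "A \<in> G" "i \<in> {1..n}" for A i
    using facet_max[OF that(1), of i] facet_nonempty[OF that(1)] that(2) xF[OF that(2)] F_not_singleton[OF that(2)]
    by blast
  have R: "R = mpoly_ring V" by (simp add: assms(10) vertices)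
  have I: "I = genideal (mpoly_ring V) (sqfree_monomial ` G)"
    by (simp add: assms(11) facet_ideal_eq vertices G_def)
  have gens: "sqfree_monomial ` G \<subseteq> (polys V :: ('v, 'k) mpolynomial set)"
    using facet_V by (auto intro: sqfree_monomial_polys)
  have I_ideal: "ideal I (mpoly_ring V)" unfolding I by (rule ideal_genideal[OF gens])
  have gen_I: "sqfree_monomial A \<in> I" if "A \<in> G" for A unfolding I using subset_genideal[OF gens] that by blast
  have I_P: "I \<subseteq> var_ideal V X"
    unfolding I
  proof (rule genideal_least[OF gens ideal_var_ideal], rule image_subsetI)
    fix A assume A: "A \<in> G"
    obtain v where v: "v \<in> A" "v \<in> X" using facet_cases[OF A] facet_nonempty[OF A] xF X_def by blast
    have "(sqfree_monomial {v} :: ('v, 'k) mpolynomial) \<in> var_ideal V X" using v XV by (auto simp: sqfree_monomial_def var_in_var_ideal_iff)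
    then show "(sqfree_monomial A :: ('v, 'k) mpolynomial) \<in> var_ideal V X"
      by (rule sqfree_monomial_in_ideal[OF ideal_var_ideal]) (use v facet_V[OF A] finV in auto)
  qed
  have height: "ideal_height R I = enat n"
  proof (rule antisym)
    have "ideal_height R I \<le> prime_height R (var_ideal V X)"
      unfolding ideal_height_def R
      by (intro Inf_lower CollectI exI[of _ "var_ideal V X"] conjI refl primeideal_var_ideal finV I_P)
    also have "\<dots> \<le> enat n" unfolding R cardX[symmetric] by (rule prime_height_var_ideal_le[OF finV XV])
    finally show "ideal_height R I \<le> enat n" .
    show "enat n \<le> ideal_height R I"
      unfolding ideal_height_def R
    proof (rule Inf_greatest, clarify)
      fix P :: "('v, 'k) mpolynomial set"
      assume P: "primeideal P (mpoly_ring V)" and IP: "I \<subseteq> P"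
      have "\<exists>v\<in>F i. mpoly_var v \<in> P" if i: "i \<in> {1..n}" for i
        by (rule primeideal_sqfree_monomial[OF P FV[OF i] finF[OF i]]) (use gen_I[OF whisker_facet[OF i]] IP in blast)
      then have "\<forall>i\<in>{1..n}. \<exists>v. v \<in> F i \<and> mpoly_var v \<in> P" by blast
      from bchoice[OF this] obtain y where y: "\<And>i. i \<in> {1..n} \<Longrightarrow> y i \<in> F i \<and> mpoly_var (y i) \<in> P" by blast
      show "enat n \<le> prime_height (mpoly_ring V) P"
      proof (rule number_of_vars_le_prime_height[OF finV P])
        show "inj_on (\<lambda>i. y (Suc i)) {..<n}"
        proof (rule inj_onI)
          fix i j assume ij: "i \<in> {..<n}" "j \<in> {..<n}" "y (Suc i) = y (Suc j)"
          then have "y (Suc i) \<in> F (Suc i) \<inter> F (Suc j)" using y[of "Suc i"] y[of "Suc j"] by auto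
          then show "i = j" using disjoint[of "Suc i" "Suc j"] ij by auto
        qed
        show "y (Suc i) \<in> V" "mpoly_var (y (Suc i)) \<in> P" if "i < n" for i
          using y[of "Suc i"] FV[of "Suc i"] that by auto
      qed
    qed
  qed
  have ara: "arithmetical_rank R I = enat n"
  proof (rule antisym)
    show "enat n \<le> arithmetical_rank R I"
      unfolding arithmetical_rank_def
    proof (rule Inf_greatest, clarify)
      fix as :: "('v, 'k) mpolynomial list"
      assume as: "set as \<subseteq> carrier R" "ideal_radical R (genideal R (set as)) = ideal_radical R I"
      have "card X \<le> length as"
      proof (rule card_le_length_radical_generators[OF finV XV I_P])
        fix v assume "v \<in> X"
        then obtain i where i: "i \<in> {1..n}" "v = x i" by (auto simp: X_def)
        have "F i - {x i} \<subseteq> V - X" using FX[OF i(1)] FV[OF i(1)] by blast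
        moreover have "(sqfree_monomial (F i) :: ('v, 'k) mpolynomial)
            = mpoly_var v * (\<Prod>w\<in>F i - {x i}. mpoly_var w)"
          unfolding sqfree_monomial_def i(2) by (rule prod.remove[OF finF[OF i(1)] xF[OF i(1)]])
        then have "mpoly_var v * (\<Prod>w\<in>F i - {x i}. mpoly_var w) \<in> I"
          using gen_I[OF whisker_facet[OF i(1)]] by simp
        ultimately show "\<exists>W. W \<subseteq> V - X \<and> mpoly_var v * (\<Prod>w\<in>W. mpoly_var w) \<in> I" by blast
      qed (use as in \<open>simp_all add: R polys_def\<close>)
      then show "enat n \<le> enat (length as)" by (simp add: cardX)
    qed
    define W where "W S = (\<Union>i\<in>{i\<in>{1..n}. x i \<in> S}. F i)" for S
    define supp where "supp S = (if \<exists>A\<in>G. A \<subseteq> S then S else W S)" for S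
    define m :: "'v set \<Rightarrow> ('v, 'k) mpolynomial" where "m S = sqfree_monomial (supp S)" for S
    define q where "q k = (\<Sum>S | S \<subseteq> X \<and> card S = k. m S)" for k
    define as where "as = map q [1..<Suc n]"
    have set_as: "set as = q ` {1..n}"
      by (simp only: as_def set_map set_upt atLeastLessThanSuc_atLeastAtMost)
    let ?J = "genideal (mpoly_ring V) (set as)"
    have S_W: "S \<subseteq> W S" if "S \<subseteq> X" for S using that xF by (force simp: W_def X_def)
    have W_V: "W S \<subseteq> V" for S using FV by (auto simp: W_def)
    have supp_V: "supp S \<subseteq> V" if "S \<subseteq> X" for S using that XV W_V by (auto simp: supp_def)
    have m_I: "m S \<in> I" if S: "S \<subseteq> X" "S \<noteq> {}" for S
    proof -
      have "\<exists>A\<in>G. A \<subseteq> supp S"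
      proof (cases "\<exists>A\<in>G. A \<subseteq> S")
        case False
        obtain v where "v \<in> S" "v \<in> X" using S by blast
        then obtain i where "i \<in> {1..n}" "x i \<in> S" unfolding X_def by blast
        then have "F i \<subseteq> W S" by (auto simp: W_def)
        then show ?thesis using False whisker_facet[OF \<open>i \<in> {1..n}\<close>] by (auto simp: supp_def)
      qed (simp add: supp_def)
      then show ?thesis unfolding m_def
        using sqfree_monomial_in_ideal[OF I_ideal gen_I _ supp_V[OF S(1)] finV] by blast
    qed
    have q_I: "q k \<in> I" if "k \<ge> 1" for k
      unfolding q_def by (rule ideal_sum[OF I_ideal], rule m_I) (use that in auto)
    have as_I: "set as \<subseteq> I" using q_I by (auto simp: set_as)
    have I_polys: "I \<subseteq> polys V" using I_P by (auto simp: var_ideal_def)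
    have as_polys: "set as \<subseteq> polys V" using as_I I_polys by blast
    have m_rad: "m S \<in> ideal_radical (mpoly_ring V) ?J" if S: "S \<subseteq> X" "S \<noteq> {}" for S
    proof (rule Schmitt_Vogel_subset_lattice[OF finX ideal_genideal[OF as_polys] _ _ _ S])
      show "m S \<in> polys V" if "S \<subseteq> X" "S \<noteq> {}" for S using m_I[OF that] I_polys by blast
      show "\<exists>r\<in>polys V. m S * m T = r * m (S \<union> T)" if ST: "S \<subseteq> X" "T \<subseteq> X" for S T
        unfolding m_def
      proof (rule sqfree_monomial_mult[OF finV supp_V[OF ST(1)] supp_V[OF ST(2)]])
        \<comment> \<open>If \<open>S \<union> T\<close> contains a facet, this holds since \<open>S\<close> and \<open>T\<close> lie in their supports; if not,
          then neither does \<open>S\<close> or \<open>T\<close>, and \<open>W\<close> is additive.\<close>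
        show "supp (S \<union> T) \<subseteq> supp S \<union> supp T"
        proof (cases "\<exists>A\<in>G. A \<subseteq> S \<union> T")
          case True
          then show ?thesis using S_W[OF ST(1)] S_W[OF ST(2)] by (auto simp: supp_def)
        next
          case False
          then have "\<not> (\<exists>A\<in>G. A \<subseteq> S)" "\<not> (\<exists>A\<in>G. A \<subseteq> T)" by blast+
          then show ?thesis using False by (simp add: supp_def) (auto simp: W_def)
        qed
      qed
      show "(\<Sum>S | S \<subseteq> X \<and> card S = k. m S) \<in> ?J" if k: "k \<in> {1..card X}" for k
      proof -
        have "q k \<in> set as" using k unfolding set_as cardX by blast
        then show ?thesis using subset_genideal[OF as_polys] unfolding q_def by blast
      qed
    qed
    have "ideal_radical (mpoly_ring V) ?J = ideal_radical (mpoly_ring V) I"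
      unfolding I
    proof (rule ideal_radical_genideal_eqI[OF as_polys gens])
      show "set as \<subseteq> ideal_radical (mpoly_ring V) (genideal (mpoly_ring V) (sqfree_monomial ` G))"
        using as_I subset_ideal_radical[OF I_polys] unfolding I by blast
      show "sqfree_monomial ` G \<subseteq> ideal_radical (mpoly_ring V) ?J"
      proof (rule image_subsetI)
        fix A assume A: "A \<in> G"
        consider "A \<subseteq> X" | i where "i \<in> {1..n}" "A = F i" using facet_cases[OF A] by blast
        then show "sqfree_monomial A \<in> ideal_radical (mpoly_ring V) ?J"
        proof cases
          case 1
          \<comment> \<open>The set \<open>A\<close> contains a facet, namely itself.\<close>
          have "supp A = A" using A by (auto simp: supp_def)
          then show ?thesis using m_rad[OF 1 facet_nonempty[OF A]] by (simp add: m_def)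
        next
          case 2
          \<comment> \<open>A single vertex contains no facet, so its monomial is that of \<open>F i\<close>.\<close>
          have "{j \<in> {1..n}. x j \<in> {x i}} = {i}" using 2(1) inj_onD[OF assms(3)] by blast
          then have "W {x i} = F i" unfolding W_def by simp
          moreover have "\<not> (\<exists>B\<in>G. B \<subseteq> {x i})" using no_facet_singleton 2(1) by blast
          ultimately have "supp {x i} = A" unfolding supp_def 2(2) by simp
          moreover have "{x i} \<subseteq> X" using 2(1) by (simp add: X_def)
          ultimately have "sqfree_monomial A = m {x i}" and "m {x i} \<in> ideal_radical (mpoly_ring V) ?J"
            using m_rad[of "{x i}"] by (simp_all add: m_def)
          then show ?thesis by simp
        qed
      qed
    qed
    then have "enat n \<in> {enat s | s. \<exists>as. length as = s \<and> set as \<subseteq> carrier R \<and>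
        ideal_radical R (genideal R (set as)) = ideal_radical R I}"
      using as_polys by (intro CollectI exI[of _ n] conjI refl exI[of _ as])
        (simp_all add: as_def R carrier_mpoly_ring del: mpoly_ring_simps(1))
    then show "arithmetical_rank R I \<le> enat n" unfolding arithmetical_rank_def by (rule Inf_lower)
  qed
  have "1 \<notin> I" using I_P by (auto simp: var_ideal_def)
  then have "I \<noteq> carrier R" by (auto simp: R)
  then show ?thesis using height ara I_ideal by (simp add: set_theoretic_complete_intersection_def R)
qed

end
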